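(* Let $\nu\ge1$. For $n\ge4$ let $dk_n$ be the normalized eigenvalue counting measure of the connection Laplacian $L(C_n^\nu)$ of the $\nu$-torus $C_n^\nu=C_n\times\cdots\times C_n$ ($\nu$ factors). Then the weak limit $dk=\lim_{n\to\infty}dk_n$ exists, is absolutely continuous with respect to Lebesgue measure, and has support away from $0$ (there is an open interval around $0$ disjoint from the support of $dk$). The limiting operator, the connection Laplacian of the lattice $\mathbb{Z}^\nu$, is almost periodic, bounded and invertible.
   Context: $C_n$ is the one-dimensional simplicial complex of the cyclic graph with $n$ vertices: its simplices are the $n$ vertices $\{j\}$ and the $n$ edges $\{j,j+1\}$, $j\in\mathbb{Z}/n\mathbb{Z}$. The cells of the product $C_n^\nu$ are the sets $x_1\times\cdots\times x_\nu$ with $x_i\in C_n$. The connection Laplacian $L(C_n^\nu)$ is the symmetric $(2n)^\nu\times(2n)^\nu$ matrix indexed by cells with $L(x,y)=1$ if $x\cap y\neq\emptyset$ and $L(x,y)=0$ otherwise. The measure $dk_n$ gives mass $(2n)^{-\nu}$ to each eigenvalue of $L(C_n^\nu)$, counted with multiplicity. The lattice $\mathbb{Z}$ is regarded as the infinite one-dimensional complex with simplices $\{j\}$ and $\{j,j+1\}$, $j\in\mathbb{Z}$, and the lattice $\mathbb{Z}^\nu$ as the $\nu$-fold product, with cells $x_1\times\cdots\times x_\nu$. Its connection Laplacian is the operator on $\ell^2$ of the set of cells with the same matrix entries ($L(x,y)=1$ if $x\cap y\ne\emptyset$ and $0$ otherwise). Enumerating the simplices of $\mathbb{Z}$ along the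 line by the integers ($\{j\}\leftrightarrow 2j$, $\{j,j+1\}\leftrightarrow2j+1$), it becomes an operator on $\ell^2(\mathbb{Z}^\nu)$; it is called almost periodic if for every $m\in\mathbb{Z}^\nu$ the function $i\mapsto L(i,i+m)$ is an almost periodic function on $\mathbb{Z}^\nu$. Invertible means having a bounded inverse. *)

theory Defs
  imports "HOL-Probability.Probability" "Jordan_Normal_Form.Spectral_Radius"
begin

section \<open>Complexes and their products\<close>

text \<open>
  The vertex set of the cyclic graph is the set of residues \<open>{0..<n}\<close>. A one-dimensional
  complex is given by the set of its simplices, each simplex being its set of vertices. The
  number of factors of a product is the size of a finite index type \<open>'v\<close>, hence at least 1.
\<close>

definition cycle_complex :: "nat \<Rightarrow> int set set" where
  "cycle_complex n =
     {{j} | j. j \<in> {0..<int n}} \<union> {{j, (j + 1) mod int n} | j. j \<in> {0..<int n}}"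

definition line_complex :: "int set set" where
  "line_complex = {{j} | j. True} \<union> {{j, j + 1} | j. True}"

definition product_cells :: "int set set \<Rightarrow> ('v::finite \<Rightarrow> int) set set" where
  "product_cells K = {Pi UNIV x | x. \<forall>k. x k \<in> K}"

definition connection :: "'a set \<Rightarrow> 'a set \<Rightarrow> 'b::zero_neq_one" where
  "connection x y = of_bool (x \<inter> y \<noteq> {})"

section \<open>Eigenvalue counting measures on tori\<close>

text \<open>
  Library matrices are indexed by initial segments of the natural numbers, so the cells have to
  be enumerated; another enumeration conjugates the matrix by a permutation matrix, which
  changes neither the eigenvalues nor their multiplicities.
\<close>

definition connection_matrix :: "'a set set \<Rightarrow> real mat" where
  "connection_matrix X =
     (let e = (SOME e. bij_betw e {0..<card X} X)
      in mat (card X) (card X) (\<lambda>(i, j). connection (e i) (e j)))"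

text \<open>
  The measure giving mass \<open>c\<close> to each eigenvalue, counted with algebraic multiplicity; for the
  symmetric matrices above this is also the geometric multiplicity, and all eigenvalues are real.
\<close>

definition eigenvalue_measure :: "real \<Rightarrow> real mat \<Rightarrow> real measure" where
  "eigenvalue_measure c A =
     distr (point_measure (spectrum A) (\<lambda>t. ennreal (c * real (order t (char_poly A)))))
       borel (\<lambda>t. t)"

definition torus_dk :: "'v::finite itself \<Rightarrow> nat \<Rightarrow> real measure" where
  "torus_dk _ n =
     eigenvalue_measure (1 / (2 * real n) ^ CARD('v))
       (connection_matrix (product_cells (cycle_complex n) :: ('v \<Rightarrow> int) set set))"

definition measure_support :: "'a::topological_space measure \<Rightarrow> 'a set" where
  "measure_support M = {t. \<forall>U. open U \<and> t \<in> U \<longrightarrow> emeasure M U > 0}"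

section \<open>Operators on square-summable functions\<close>

text \<open>
  The Hilbert space of square-summable functions on a set \<open>X\<close>, realised by the functions vanishing
  off \<open>X\<close>.
\<close>

definition l2 :: "'a set \<Rightarrow> ('a \<Rightarrow> complex) set" where
  "l2 X = {f. (\<forall>x. x \<notin> X \<longrightarrow> f x = 0) \<and> (\<lambda>x. (cmod (f x))\<^sup>2) summable_on X}"

definition l2_norm :: "'a set \<Rightarrow> ('a \<Rightarrow> complex) \<Rightarrow> real" where
  "l2_norm X f = sqrt (\<Sum>\<^sub>\<infinity>x\<in>X. (cmod (f x))\<^sup>2)"

definition bounded_l2_operator ::
    "'a set \<Rightarrow> (('a \<Rightarrow> complex) \<Rightarrow> 'a \<Rightarrow> complex) \<Rightarrow> bool" where
  "bounded_l2_operator X T \<longleftrightarrow>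
     (\<forall>f\<in>l2 X. T f \<in> l2 X) \<and>
     (\<forall>f\<in>l2 X. \<forall>g\<in>l2 X. T (\<lambda>x. f x + g x) = (\<lambda>x. T f x + T g x)) \<and>
     (\<forall>a. \<forall>f\<in>l2 X. T (\<lambda>x. a * f x) = (\<lambda>x. a * T f x)) \<and>
     (\<exists>C. \<forall>f\<in>l2 X. l2_norm X (T f) \<le> C * l2_norm X f)"

definition invertible_l2_operator ::
    "'a set \<Rightarrow> (('a \<Rightarrow> complex) \<Rightarrow> 'a \<Rightarrow> complex) \<Rightarrow> bool" where
  "invertible_l2_operator X T \<longleftrightarrow>
     (\<exists>S. bounded_l2_operator X S \<and> (\<forall>f\<in>l2 X. S (T f) = f \<and> T (S f) = f))"

text \<open>
  Each cell of the lattice meets only finitely many cells, so the sum below has finite support.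
\<close>

definition lattice_laplacian ::
    "((('v::finite \<Rightarrow> int) set) \<Rightarrow> complex) \<Rightarrow> ('v \<Rightarrow> int) set \<Rightarrow> complex" where
  "lattice_laplacian f x =
     (if x \<in> product_cells line_complex
      then \<Sum>\<^sub>\<infinity>y\<in>product_cells line_complex. connection x y * f y else 0)"

section \<open>Almost periodicity\<close>

definition line_simplex :: "int \<Rightarrow> int set" where
  "line_simplex i = (if even i then {i div 2} else {i div 2, i div 2 + 1})"

definition lattice_cell :: "('v::finite \<Rightarrow> int) \<Rightarrow> ('v \<Rightarrow> int) set" where
  "lattice_cell i = Pi UNIV (\<lambda>k. line_simplex (i k))"

definition lattice_entry :: "('v::finite \<Rightarrow> int) \<Rightarrow> ('v \<Rightarrow> int) \<Rightarrow> complex" where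
  "lattice_entry i j = connection (lattice_cell i) (lattice_cell j)"

text \<open>
  Almost periodicity in the sense of Bohr: for every \<open>\<epsilon>\<close> the \<open>\<epsilon>\<close>-almost periods are relatively
  dense, that is, every cube of some fixed size contains one.
\<close>

definition almost_periodic :: "(('v::finite \<Rightarrow> int) \<Rightarrow> complex) \<Rightarrow> bool" where
  "almost_periodic f \<longleftrightarrow>
     (\<forall>\<epsilon>>0. \<exists>R. \<forall>a. \<exists>p. (\<forall>k. \<bar>p k - a k\<bar> \<le> R) \<and>
        (\<forall>i. cmod (f (\<lambda>k. i k + p k) - f i) < \<epsilon>))"

definition almost_periodic_operator ::
    "(('v::finite \<Rightarrow> int) \<Rightarrow> ('v \<Rightarrow> int) \<Rightarrow> complex) \<Rightarrow> bool" where
  "almost_periodic_operator A \<longleftrightarrow> (\<forall>m. almost_periodic (\<lambda>i. A i (\<lambda>k. i k + m k)))"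

end

theory Submission
  imports Defs "HOL-Real_Asymp.Real_Asymp"
begin

text \<open>
  Everything rests on the product structure. Two product cells meet iff they meet in every
  coordinate, so the connection Laplacian of a product is the tensor product of the connection
  Laplacians of its factors, and all questions reduce to the cycle and to the line.

  On the line, the Fourier transform turns the Laplacian into multiplication by the Hermitian matrix
  with rows \<open>(1, 1 + z)\<close> and \<open>(1 + w, 1 + 2 cos \<theta>)\<close>, where \<open>w = exp (i\<theta>)\<close>, \<open>z\<close> is its conjugate,
  and the first coordinate belongs to the vertices, the second to the edges. Its determinant is
  \<open>-1\<close> for every \<open>\<theta>\<close> and its trace is \<open>2 + 2 cos \<theta>\<close>. The eigenvalues are therefore the two
  branches \<open>1 + cos \<theta> \<plusminus> sqrt ((1 + cos \<theta>)^2 + 1)\<close>, which stay away from \<open>0\<close>; and the inverse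
  matrix again has trigonometric polynomials as entries, so that the inverse of the lattice
  Laplacian is an explicit kernel of finite range. A finite range kernel with bounded entries is a
  bounded operator on square-summable functions, whence the lattice Laplacian is bounded and
  invertible; and its entries have period 2 in every coordinate, whence it is almost periodic.

  For the torus, the Fourier modes with frequencies \<open>2\<pi>m/n\<close> diagonalise the Laplacian explicitly
  (\<open>cycle_diagonalises\<close>). The two branches are laid out one after the other over
  the unit interval as a single function \<open>line_spectrum\<close>, so that the eigenvalues of the torus are the
  products of the values of this function over the points of the grid of mesh \<open>1/(2n)\<close> in the unit
  cube. Rounding a uniformly distributed point of the cube down to the grid gives a uniformly
  distributed grid point; hence all the measures \<open>dk\<^sub>n\<close> are laws of random variables on one and
  the same probability space (\<open>torus_dk_eq_distr\<close>), and these converge pointwise to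
  the product of the values of \<open>line_spectrum\<close> at the point itself. Levy's continuity theorem turns
  this into weak convergence of the laws.

  The limit law is that of a product of independent nonzero variables. Fixing all but one of them
  reduces absolute continuity to a single factor, and there it holds because \<open>cos \<theta>\<close>, and thus
  \<open>\<theta>\<close> up to countably many choices, is a differentiable function of the eigenvalue
  (\<open>negligible_line_spectrum_vimage\<close>).
\<close>

section \<open>Diagonalised kernels and their eigenvalue measures\<close>

text \<open>
  The columns of \<open>P\<close> are eigenvectors of the kernel \<open>L\<close> on \<open>X\<close>, labelled by \<open>C\<close>, and \<open>Q\<close> is a
  left inverse of \<open>P\<close>. Kernels on arbitrary index sets are used because they pass to tensor
  products without any renumbering.
\<close>

definition diagonalises ::
    "'x set \<Rightarrow> ('x \<Rightarrow> 'x \<Rightarrow> real) \<Rightarrow> 'c set \<Rightarrow> ('c \<Rightarrow> real) \<Rightarrow>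
     ('x \<Rightarrow> 'c \<Rightarrow> complex) \<Rightarrow> ('c \<Rightarrow> 'x \<Rightarrow> complex) \<Rightarrow> bool" where
  "diagonalises X L C eig P Q \<longleftrightarrow>
     (\<forall>c\<in>C. \<forall>c'\<in>C. (\<Sum>x\<in>X. Q c x * P x c') = of_bool (c = c')) \<and>
     (\<forall>x\<in>X. \<forall>c\<in>C. (\<Sum>y\<in>X. complex_of_real (L x y) * P y c) = complex_of_real (eig c) * P x c)"

lemma diagonalises_reindex_cells:
  assumes "diagonalises X (\<lambda>x y. L (f x) (f y)) C eig P Q" "bij_betw f X Y"
  shows "diagonalises Y L C eig (\<lambda>y. P (inv_into X f y)) (\<lambda>c y. Q c (inv_into X f y))"
proof -
  have inv: "inv_into X f (f x) = x" if "x \<in> X" for x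
    using that assms(2) by (simp add: bij_betw_def)
  have sum: "(\<Sum>y\<in>Y. g y) = (\<Sum>x\<in>X. g (f x))" for g :: "_ \<Rightarrow> complex"
    using sum.reindex_bij_betw[OF assms(2)] by metis
  show ?thesis
    unfolding diagonalises_def
  proof (intro conjI ballI)
    fix c c' assume "c \<in> C" "c' \<in> C"
    then show "(\<Sum>y\<in>Y. Q c (inv_into X f y) * P (inv_into X f y) c') = of_bool (c = c')"
      using assms(1) unfolding diagonalises_def by (simp add: sum inv)
  next
    fix y c assume "y \<in> Y" "c \<in> C"
    then obtain x where x: "x \<in> X" "y = f x"
      using assms(2) by (auto simp: bij_betw_def)
    have "(\<Sum>y'\<in>Y. complex_of_real (L y y') * P (inv_into X f y') c)
        = (\<Sum>x'\<in>X. complex_of_real (L (f x) (f x')) * P x' c)"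
      by (simp add: sum inv x(2))
    also have "\<dots> = complex_of_real (eig c) * P x c"
      using assms(1) x(1) \<open>c \<in> C\<close> unfolding diagonalises_def by blast
    finally show "(\<Sum>y'\<in>Y. complex_of_real (L y y') * P (inv_into X f y') c)
        = complex_of_real (eig c) * P (inv_into X f y) c"
      by (simp add: x inv)
  qed
qed

lemma diagonalises_reindex_eigenvalues:
  assumes "diagonalises X L C eig P Q" "inj_on f D" "f ` D \<subseteq> C"
  shows "diagonalises X L D (\<lambda>d. eig (f d)) (\<lambda>x d. P x (f d)) (\<lambda>d. Q (f d))"
proof -
  have "f d \<in> C" if "d \<in> D" for d using that assms(3) by auto
  then show ?thesis
    using assms(1,2) unfolding diagonalises_def by (auto simp: inj_on_eq_iff)
qed

text \<open>
  A sum over all functions of a product over the coordinates is the product of the sums, so both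
  conditions can be checked one coordinate at a time.
\<close>

lemma diagonalises_tensor:
  fixes C :: "'c set" and X :: "'x set"
  assumes d: "diagonalises X L C eig P Q" and fin: "finite X"
  shows "diagonalises {x :: 'v::finite \<Rightarrow> 'x. \<forall>k. x k \<in> X} (\<lambda>x y. \<Prod>k\<in>UNIV. L (x k) (y k))
           {c. \<forall>k. c k \<in> C} (\<lambda>c. \<Prod>k\<in>UNIV. eig (c k))
           (\<lambda>x c. \<Prod>k\<in>UNIV. P (x k) (c k)) (\<lambda>c x. \<Prod>k\<in>UNIV. Q (c k) (x k))"
proof -
  have eq: "{x :: 'v \<Rightarrow> 'x. \<forall>k. x k \<in> X} = PiE UNIV (\<lambda>_. X)" by (auto simp: PiE_def Pi_def)
  have sum: "(\<Sum>x\<in>{x :: 'v \<Rightarrow> 'x. \<forall>k. x k \<in> X}. \<Prod>k\<in>UNIV. f k (x k)) = (\<Prod>k\<in>UNIV. \<Sum>x\<in>X. f k x)"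
    for f :: "'v \<Rightarrow> 'x \<Rightarrow> complex"
    unfolding eq using prod_sum_PiE[of UNIV "\<lambda>_. X" f] fin by simp
  show ?thesis
    unfolding diagonalises_def
  proof safe
    fix c c' :: "'v \<Rightarrow> 'c" assume c: "\<forall>k. c k \<in> C" "\<forall>k. c' k \<in> C"
    have "(\<Sum>x\<in>{x :: 'v \<Rightarrow> 'x. \<forall>k. x k \<in> X}. (\<Prod>k\<in>UNIV. Q (c k) (x k)) * (\<Prod>k\<in>UNIV. P (x k) (c' k)))
        = (\<Prod>k\<in>UNIV. \<Sum>x\<in>X. Q (c k) x * P x (c' k))"
      using sum[of "\<lambda>k x. Q (c k) x * P x (c' k)"] by (simp only: prod.distrib)
    also have "\<dots> = (\<Prod>k\<in>UNIV. of_bool (c k = c' k))"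
      using d c unfolding diagonalises_def by (intro prod.cong) auto
    also have "\<dots> = of_bool (c = c')"
    proof (cases "c = c'")
      case False
      then obtain k where "c k \<noteq> c' k" by auto
      then show ?thesis using False by (auto intro!: prod_zero)
    qed simp
    finally show "(\<Sum>x\<in>{x :: 'v \<Rightarrow> 'x. \<forall>k. x k \<in> X}. (\<Prod>k\<in>UNIV. Q (c k) (x k)) * (\<Prod>k\<in>UNIV. P (x k) (c' k)))
        = of_bool (c = c')" .
  next
    fix x :: "'v \<Rightarrow> 'x" and c :: "'v \<Rightarrow> 'c" assume c: "\<forall>k. x k \<in> X" "\<forall>k. c k \<in> C"
    have "(\<Sum>y\<in>{x :: 'v \<Rightarrow> 'x. \<forall>k. x k \<in> X}. complex_of_real (\<Prod>k\<in>UNIV. L (x k) (y k)) * (\<Prod>k\<in>UNIV. P (y k) (c k)))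
        = (\<Prod>k\<in>UNIV. \<Sum>y\<in>X. complex_of_real (L (x k) y) * P y (c k))"
      using sum[of "\<lambda>k y. complex_of_real (L (x k) y) * P y (c k)"]
      by (simp only: prod.distrib of_real_prod)
    also have "\<dots> = (\<Prod>k\<in>UNIV. complex_of_real (eig (c k)) * P (x k) (c k))"
      using d c unfolding diagonalises_def by (intro prod.cong) auto
    finally show "(\<Sum>y\<in>{x :: 'v \<Rightarrow> 'x. \<forall>k. x k \<in> X}. complex_of_real (\<Prod>k\<in>UNIV. L (x k) (y k)) * (\<Prod>k\<in>UNIV. P (y k) (c k)))
        = complex_of_real (\<Prod>k\<in>UNIV. eig (c k)) * (\<Prod>k\<in>UNIV. P (x k) (c k))"
      by (simp add: prod.distrib)
  qed
qed

lemma of_real_poly_eq: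
  assumes "map_poly complex_of_real p = map_poly complex_of_real q"
  shows "p = q"
proof (rule poly_eqI)
  fix i
  have "coeff (map_poly complex_of_real p) i = coeff (map_poly complex_of_real q) i"
    using assms by simp
  then show "coeff p i = coeff q i" by (simp add: coeff_map_poly)
qed

text \<open>
  Both \<open>P\<close> and \<open>Q\<close> become square matrices, so the left inverse is an inverse and the matrix is
  similar to a diagonal one. The similarity lives over the complex numbers; as the eigenvalues are
  real and the embedding of real into complex polynomials is injective, the factorisation of the
  characteristic polynomial descends to the reals.
\<close>

lemma char_poly_connection_matrix:
  assumes d: "diagonalises X connection C eig P Q"
    and fin: "finite X" "finite C" and card: "card C = card X"
  shows "char_poly (connection_matrix X) = (\<Prod>c\<in>C. [:- eig c, 1:])"
proof -
  interpret lift: map_poly_comm_ring_hom complex_of_real ..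
  define N where "N = card X"
  define e where "e = (SOME e. bij_betw e {0..<card X} X)"
  have e: "bij_betw e {0..<N} X"
    unfolding e_def N_def using ex_bij_betw_nat_finite[OF fin(1)] by (rule someI_ex)
  obtain g where g: "bij_betw g {0..<N} C"
    using ex_bij_betw_nat_finite[OF fin(2)] card N_def by auto
  let ?A = "connection_matrix X"
  have A: "?A = mat N N (\<lambda>(i, j). connection (e i) (e j))"
    unfolding connection_matrix_def by (simp add: N_def e_def Let_def)
  define AA where "AA = map_mat complex_of_real ?A"
  define PP where "PP = mat N N (\<lambda>(i, j). P (e i) (g j))"
  define QQ where "QQ = mat N N (\<lambda>(i, j). Q (g i) (e j))"
  define D where "D = mat N N (\<lambda>(i, j). if i = j then complex_of_real (eig (g i)) else 0)"
  have carr: "?A \<in> carrier_mat N N" "AA \<in> carrier_mat N N" "PP \<in> carrier_mat N N"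
    "QQ \<in> carrier_mat N N" "D \<in> carrier_mat N N"
    by (auto simp: A AA_def PP_def QQ_def D_def)
  have eX: "e i \<in> X" and gC: "g i \<in> C" if "i < N" for i
    using that e g by (auto simp: bij_betw_def)
  have ginj: "g i = g j \<longleftrightarrow> i = j" if "i < N" "j < N" for i j
    using that g by (auto simp: bij_betw_def inj_on_def)
  have sum: "(\<Sum>i = 0..<N. h (e i)) = (\<Sum>x\<in>X. h x)" for h :: "_ \<Rightarrow> complex"
    using sum.reindex_bij_betw[OF e] .
  have QP: "QQ * PP = 1\<^sub>m N"
  proof (rule eq_matI)
    fix i j assume ij: "i < dim_row (1\<^sub>m N)" "j < dim_col (1\<^sub>m N)"
    then have "(QQ * PP) $$ (i, j) = (\<Sum>k = 0..<N. Q (g i) (e k) * P (e k) (g j))"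
      by (simp add: QQ_def PP_def scalar_prod_def)
    also have "\<dots> = (\<Sum>x\<in>X. Q (g i) x * P x (g j))"
      by (rule sum)
    also have "\<dots> = of_bool (g i = g j)"
      using d gC ij unfolding diagonalises_def by simp
    finally show "(QQ * PP) $$ (i, j) = 1\<^sub>m N $$ (i, j)"
      using ij by (simp add: ginj)
  qed (use carr in auto)
  have PQ: "PP * QQ = 1\<^sub>m N"
    by (rule mat_mult_left_right_inverse[OF carr(4,3) QP])
  have AP: "AA * PP = PP * D"
  proof (rule eq_matI)
    fix i j assume ij: "i < dim_row (PP * D)" "j < dim_col (PP * D)"
    then have ij': "i < N" "j < N" using carr by auto
    then have "(AA * PP) $$ (i, j) = (\<Sum>k = 0..<N. complex_of_real (connection (e i) (e k)) * P (e k) (g j))"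
      by (simp add: AA_def A PP_def scalar_prod_def)
    also have "\<dots> = (\<Sum>y\<in>X. complex_of_real (connection (e i) y) * P y (g j))"
      by (rule sum)
    also have "\<dots> = complex_of_real (eig (g j)) * P (e i) (g j)"
      using d eX gC ij' unfolding diagonalises_def by blast
    also have "\<dots> = (\<Sum>k = 0..<N. P (e i) (g k) * (if k = j then complex_of_real (eig (g k)) else 0))"
      using ij' by (simp add: if_distrib[of "\<lambda>x. _ * x"] mult.commute cong: if_cong)
    also have "\<dots> = (PP * D) $$ (i, j)"
      using ij' by (simp add: PP_def D_def scalar_prod_def)
    finally show "(AA * PP) $$ (i, j) = (PP * D) $$ (i, j)" .
  qed (use carr in auto)
  have "AA = AA * (PP * QQ)" using carr PQ by simp
  also have "\<dots> = PP * D * QQ" using carr AP by (simp flip: assoc_mult_mat)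
  finally have "similar_mat AA D"
    using carr PQ QP by (intro similar_matI[of _ _ PP QQ N]) auto
  then have "char_poly AA = char_poly D" by (rule char_poly_similar)
  also have "\<dots> = (\<Prod>a\<leftarrow>diag_mat D. [:- a, 1:])"
    by (rule char_poly_upper_triangular[OF carr(5)]) (auto simp: upper_triangular_def D_def)
  also have "\<dots> = (\<Prod>i = 0..<N. [:- complex_of_real (eig (g i)), 1:])"
  proof -
    have "diag_mat D = map (\<lambda>i. complex_of_real (eig (g i))) [0..<N]"
      by (auto simp: diag_mat_def D_def)
    then show ?thesis
      using prod.distinct_set_conv_list[of "[0..<N]" "\<lambda>i. [:- complex_of_real (eig (g i)), 1:]"]
      by (simp add: o_def)
  qed
  also have "\<dots> = (\<Prod>c\<in>C. [:- complex_of_real (eig c), 1:])"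
    using prod.reindex_bij_betw[OF g, of "\<lambda>c. [:- complex_of_real (eig c), 1:]"] .
  also have "\<dots> = map_poly complex_of_real (\<Prod>c\<in>C. [:- eig c, 1:])"
    by (simp add: lift.hom_prod hom_distribs)
  finally have "char_poly AA = map_poly complex_of_real (\<Prod>c\<in>C. [:- eig c, 1:])" .
  moreover have "char_poly AA = map_poly complex_of_real (char_poly ?A)"
    unfolding AA_def by (rule of_real_hom.char_poly_hom[OF carr(1)])
  ultimately have "map_poly complex_of_real (char_poly ?A) = map_poly complex_of_real (\<Prod>c\<in>C. [:- eig c, 1:])"
    by simp
  then show ?thesis
    by (rule of_real_poly_eq)
qed

lemma order_prod_linear:
  fixes eig :: "'c \<Rightarrow> 'a::idom"
  assumes "finite C"
  shows "order t (\<Prod>c\<in>C. [:- eig c, 1:]) = card {c \<in> C. eig c = t}"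
  using assms
proof (induction C)
  case (insert x F)
  have nz: "[:- eig x, 1:] * (\<Prod>c\<in>F. [:- eig c, 1:]) \<noteq> 0"
    using insert.hyps by (intro no_zero_divisors) (auto simp: prod_zero_iff)
  have "{c \<in> insert x F. eig c = t} = (if eig x = t then insert x {c \<in> F. eig c = t} else {c \<in> F. eig c = t})"
    by auto
  then show ?case
    using insert order_mult[OF nz, of t] by (auto simp: order_linear')
qed (simp add: order_0I)

lemma emeasure_eigenvalue_measure:
  assumes A: "A \<in> carrier_mat N N" and cp: "char_poly A = (\<Prod>c\<in>C. [:- eig c, 1:])"
    and fin: "finite C" and a: "0 \<le> a" and B: "B \<in> sets borel"
  shows "emeasure (eigenvalue_measure a A) B = ennreal (a * card {c \<in> C. eig c \<in> B})"
proof -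
  let ?f = "\<lambda>t. ennreal (a * real (order t (char_poly A)))"
  have spec: "spectrum A = eig ` C"
    unfolding spectrum_def using eigenvalue_root_char_poly[OF A] fin
    by (auto simp: cp poly_prod)
  have "emeasure (eigenvalue_measure a A) B = emeasure (point_measure (spectrum A) ?f) (B \<inter> spectrum A)"
    unfolding eigenvalue_measure_def using B
    by (subst emeasure_distr) (auto simp: measurable_point_measure_eq1 space_point_measure vimage_def Int_def)
  also have "\<dots> = (\<Sum>t\<in>B \<inter> spectrum A. ?f t)"
    using fin by (intro emeasure_point_measure_finite) (auto simp: spec)
  also have "\<dots> = ennreal (\<Sum>t\<in>B \<inter> spectrum A. a * real (card {c \<in> C. eig c = t}))"
    using a fin by (subst sum_ennreal) (auto simp: cp order_prod_linear)
  also have "(\<Sum>t\<in>B \<inter> spectrum A. a * real (card {c \<in> C. eig c = t})) = a * real (\<Sum>t\<in>B \<inter> spectrum A. card {c \<in> C. eig c = t})"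
    by (simp add: sum_distrib_left)
  also have "(\<Sum>t\<in>B \<inter> spectrum A. card {c \<in> C. eig c = t}) = card (\<Union>t\<in>B \<inter> spectrum A. {c \<in> C. eig c = t})"
    using fin by (subst card_UN_disjoint) (auto simp: spec)
  also have "(\<Union>t\<in>B \<inter> spectrum A. {c \<in> C. eig c = t}) = {c \<in> C. eig c \<in> B}"
    by (auto simp: spec)
  finally show ?thesis .
qed

section \<open>The Laplacian of the cycle\<close>

text \<open>
  The simplices of the cycle are labelled by pairs \<open>(j, s)\<close>: the vertex \<open>j\<close> if \<open>s\<close> is false and the
  edge from \<open>j\<close> to its successor if \<open>s\<close> is true. The same pairs label the eigenvalues, the first
  component being the frequency and the second one selecting the branch.
\<close>

definition cycle_simplex :: "nat \<Rightarrow> int \<times> bool \<Rightarrow> int set" where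
  "cycle_simplex n = (\<lambda>(j, s). if s then {j, (j + 1) mod int n} else {j})"

definition torus_index :: "nat \<Rightarrow> (int \<times> bool) set" where
  "torus_index n = {0..<int n} \<times> UNIV"

text \<open>
  The two roots of \<open>X^2 - (2 + 2 cos \<theta>) X - 1\<close>, the characteristic polynomial of the symbol of
  the Laplacian.
\<close>

definition branch :: "real \<Rightarrow> bool \<Rightarrow> real" where
  "branch \<theta> s = 1 + cos \<theta> + (if s then -1 else 1) * sqrt ((1 + cos \<theta>)\<^sup>2 + 1)"

text \<open>
  With \<open>\<lambda>\<close> the larger and \<open>\<mu>\<close> the smaller branch, this is both \<open>\<lambda> - (1 + 2 cos \<theta>)\<close> and \<open>1 - \<mu>\<close>.
  It is the entry of the eigenvectors of the symbol that never vanishes, unlike \<open>1 + exp (i\<theta>)\<close>,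
  which is zero for \<open>\<theta> = \<pi>\<close>.
\<close>

definition symbol_gap :: "real \<Rightarrow> real" where
  "symbol_gap \<theta> = sqrt ((1 + cos \<theta>)\<^sup>2 + 1) - cos \<theta>"

text \<open>
  The columns are the eigenvectors of the symbol, the first one (index false) for the larger branch.
  With this choice of signs the matrix is Hermitian with trace zero, so its square is scalar and
  it is its own inverse up to the factor \<open>symbol_norm\<close>.
\<close>

definition symbol_mode :: "real \<Rightarrow> bool \<Rightarrow> bool \<Rightarrow> complex" where
  "symbol_mode \<theta> a b =
     (if a then (if b then - of_real (symbol_gap \<theta>) else 1 + cis \<theta>)
      else (if b then 1 + cis (- \<theta>) else of_real (symbol_gap \<theta>)))"

definition symbol_norm :: "real \<Rightarrow> real" where
  "symbol_norm \<theta> = (symbol_gap \<theta>)\<^sup>2 + 2 + 2 * cos \<theta>"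

definition freq :: "nat \<Rightarrow> int \<Rightarrow> real" where
  "freq n m = 2 * pi * of_int m / real n"

definition cycle_mode :: "nat \<Rightarrow> int \<times> bool \<Rightarrow> int \<times> bool \<Rightarrow> complex" where
  "cycle_mode n = (\<lambda>(j, s) (m, t). cis (freq n m * of_int j) * symbol_mode (freq n m) s t)"

definition cycle_dual_mode :: "nat \<Rightarrow> int \<times> bool \<Rightarrow> int \<times> bool \<Rightarrow> complex" where
  "cycle_dual_mode n = (\<lambda>(m, t) (j, s). cis (- (freq n m * of_int j)) * symbol_mode (freq n m) t s
      / of_real (real n * symbol_norm (freq n m)))"

lemma symbol_norm_pos: "symbol_norm \<theta> > 0"
proof -
  have "\<bar>cos \<theta>\<bar> < sqrt ((1 + cos \<theta>)\<^sup>2 + 1) \<or> cos \<theta> = -1"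
  proof (cases "cos \<theta> = -1")
    case False
    then have "cos \<theta> > -1" using cos_ge_minus_one[of \<theta>] by linarith
    then have "(cos \<theta>)\<^sup>2 < (1 + cos \<theta>)\<^sup>2 + 1" by (simp add: power2_eq_square algebra_simps)
    then show ?thesis by (metis real_sqrt_abs real_sqrt_less_mono)
  qed simp
  then have "symbol_gap \<theta> > 0" unfolding symbol_gap_def by auto
  then have "(symbol_gap \<theta>)\<^sup>2 > 0" by simp
  then show ?thesis
    unfolding symbol_norm_def using cos_ge_minus_one[of \<theta>] by linarith
qed

lemma cis_cos: "cis \<theta> + cis (- \<theta>) = of_real (2 * cos \<theta>)" "cis \<theta> * cis (- \<theta>) = 1"
  by (auto simp: complex_eq_iff cis_mult)

lemma one_plus_cis: "(1 + cis \<theta>) * (1 + cis (- \<theta>)) = of_real (2 + 2 * cos \<theta>)"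
proof -
  have "(1 + cis \<theta>) * (1 + cis (- \<theta>)) = 1 + (cis \<theta> + cis (- \<theta>)) + cis \<theta> * cis (- \<theta>)"
    by (simp add: algebra_simps)
  then show ?thesis by (simp only: cis_cos) simp
qed

lemma symbol_mode_involution:
  "(\<Sum>s\<in>UNIV. symbol_mode \<theta> a s * symbol_mode \<theta> s b) = of_real (symbol_norm \<theta>) * of_bool (a = b)"
  using one_plus_cis[of \<theta>]
  by (cases a; cases b)
     (auto simp: UNIV_bool symbol_mode_def symbol_norm_def power2_eq_square mult.commute)

lemma sqrt_branch: "(sqrt ((1 + cos \<theta>)\<^sup>2 + 1))\<^sup>2 = (1 + cos \<theta>)\<^sup>2 + 1"
  by (simp add: add_nonneg_nonneg)

text \<open>
  The eigenvector equation for the row of the symbol that belongs to the vertices: a vertex meets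
  itself, the edge starting in it and the edge ending in it.
\<close>

lemma symbol_mode_vertex:
  "symbol_mode \<theta> False b + (1 + cis (- \<theta>)) * symbol_mode \<theta> True b
     = of_real (branch \<theta> b) * symbol_mode \<theta> False b"
proof (cases b)
  case True
  then show ?thesis
    by (simp add: symbol_mode_def branch_def symbol_gap_def algebra_simps)
next
  case False
  have "symbol_gap \<theta> + (2 + 2 * cos \<theta>) = branch \<theta> False * symbol_gap \<theta>"
    using sqrt_branch[of \<theta>]
    by (simp add: branch_def symbol_gap_def power2_eq_square algebra_simps)
  then have "complex_of_real (symbol_gap \<theta>) + of_real (2 + 2 * cos \<theta>) = of_real (branch \<theta> False) * of_real (symbol_gap \<theta>)"
    by (metis of_real_add of_real_mult)
  with False show ?thesis
    using one_plus_cis[of \<theta>] by (simp add: symbol_mode_def mult.commute)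
qed

text \<open>
  The eigenvector equation for the row that belongs to the edges: an edge meets its two end points,
  itself and its two neighbouring edges.
\<close>

lemma symbol_mode_edge:
  "(1 + cis \<theta>) * symbol_mode \<theta> False b + (1 + cis \<theta> + cis (- \<theta>)) * symbol_mode \<theta> True b
     = of_real (branch \<theta> b) * symbol_mode \<theta> True b"
proof -
  have c: "1 + cis \<theta> + cis (- \<theta>) = of_real (1 + 2 * cos \<theta>)"
    using cis_cos(1)[of \<theta>] by (simp add: add.assoc)
  show ?thesis
  proof (cases b)
    case False
    then show ?thesis
      unfolding c by (simp add: symbol_mode_def branch_def symbol_gap_def algebra_simps)
  next
    case True
    have "(2 + 2 * cos \<theta>) - (1 + 2 * cos \<theta>) * symbol_gap \<theta> = - (branch \<theta> True * symbol_gap \<theta>)"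
      using sqrt_branch[of \<theta>]
      by (simp add: branch_def symbol_gap_def power2_eq_square algebra_simps)
    then have "complex_of_real (2 + 2 * cos \<theta>) - of_real (1 + 2 * cos \<theta>) * of_real (symbol_gap \<theta>)
        = - (of_real (branch \<theta> True) * of_real (symbol_gap \<theta>))"
      by (metis of_real_diff of_real_mult of_real_minus)
    with True show ?thesis
      unfolding c using one_plus_cis[of \<theta>] by (simp add: symbol_mode_def)
  qed
qed

lemma cis_freq_period:
  assumes "n > 0"
  shows "cis (freq n m * of_int (j mod int n)) = cis (freq n m * of_int j)"
proof -
  have "of_int j = real_of_int (j mod int n) + real n * of_int (j div int n)"
    by (metis mod_mult_div_eq of_int_add of_int_mult of_int_of_nat_eq)
  then have "freq n m * of_int j = freq n m * of_int (j mod int n) + 2 * pi * of_int (m * (j div int n))"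
    using assms by (simp add: freq_def field_simps)
  then show ?thesis
    by (metis cis_mult cis_multiple_2pi mult.right_neutral Ints_of_int)
qed

lemma cis_freq_orthogonal:
  assumes n: "n > 0" and m: "m \<in> {0..<int n}" "m' \<in> {0..<int n}"
  shows "(\<Sum>j\<in>{0..<int n}. cis (- (freq n m * of_int j)) * cis (freq n m' * of_int j))
           = of_nat n * of_bool (m = m')"
proof -
  define z where "z = cis (freq n (m' - m))"
  have summand: "cis (- (freq n m * of_int (int j))) * cis (freq n m' * of_int (int j)) = z ^ j" for j
    by (simp add: z_def cis_mult freq_def Complex.DeMoivre algebra_simps diff_divide_distrib)
  have img: "{0..<int n} = int ` {..<n}"
    by (simp add: image_int_atLeastLessThan lessThan_atLeast0)
  have "(\<Sum>j\<in>{0..<int n}. cis (- (freq n m * of_int j)) * cis (freq n m' * of_int j))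
      = (\<Sum>j<n. z ^ j)"
    unfolding img by (subst sum.reindex) (auto simp: summand simp del: of_int_of_nat_eq)
  also have "\<dots> = of_nat n * of_bool (m = m')"
  proof (cases "m = m'")
    case True
    then show ?thesis by (simp add: z_def freq_def)
  next
    case False
    \<comment> \<open>A trivial character would force \<open>n\<close> to divide \<open>m' - m\<close>, which is smaller in absolute value.\<close>
    have "z \<noteq> 1"
    proof
      assume "z = 1"
      then have "cos (freq n (m' - m)) = 1" by (simp add: z_def complex_eq_iff)
      then obtain k :: int where "freq n (m' - m) = of_int k * 2 * pi"
        by (auto simp: cos_one_2pi_int)
      then have "2 * pi * of_int (m' - m) = 2 * pi * of_int (k * int n)"
        using n by (simp add: freq_def field_simps)
      then have "real_of_int (m' - m) = of_int (k * int n)"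
        by (simp only: mult_cancel_left) simp
      then have eq: "m' - m = k * int n" by (simp only: of_int_eq_iff)
      then have "\<bar>k * int n\<bar> < int n" using m by auto
      then have "k = 0" using n by (auto simp: abs_mult mult_less_cancel_right1)
      with eq False show False by simp
    qed
    moreover have "z ^ n = 1"
    proof -
      have "real n * freq n (m' - m) = 2 * pi * of_int (m' - m)"
        using n by (simp add: freq_def)
      then show ?thesis
        by (simp only: z_def Complex.DeMoivre) (metis cis_multiple_2pi Ints_of_int)
    qed
    ultimately show ?thesis
      using False by (simp add: geometric_sum)
  qed
  finally show ?thesis .
qed

text \<open>
  From \<open>n = 3\<close> on, the neighbours of a simplex that are listed on the right are pairwise distinct. The
  periodicity of \<open>g\<close> removes the reductions modulo \<open>n\<close>.
\<close>

lemma sum_cycle_connection: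
  fixes g :: "int \<Rightarrow> complex"
  assumes n: "n \<ge> 3" and j: "j \<in> {0..<int n}" and per: "\<And>k. g (k mod int n) = g k"
  shows "(\<Sum>i\<in>{0..<int n}. complex_of_real (connection (cycle_simplex n (j, s)) (cycle_simplex n (i, t))) * g i)
    = (if s then if t then g (j - 1) + g j + g (j + 1) else g j + g (j + 1)
       else if t then g (j - 1) + g j else g j)"
proof -
  define N where "N = (if s then if t then {(j - 1) mod int n, j, (j + 1) mod int n} else {j, (j + 1) mod int n}
       else if t then {(j - 1) mod int n, j} else {j})"
  have succ: "(i + 1) mod int n = (if i + 1 = int n then 0 else i + 1)"
    if "i \<in> {0..<int n}" for i
    using that n by (cases "i + 1 = int n") (simp_all add: mod_pos_pos_trivial)
  have pred: "(j - 1) mod int n = (if j = 0 then int n - 1 else j - 1)"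
    using j n by (auto simp: mod_pos_pos_trivial zmod_minus1)
  have N: "{i \<in> {0..<int n}. cycle_simplex n (j, s) \<inter> cycle_simplex n (i, t) \<noteq> {}} = N"
    unfolding N_def cycle_simplex_def using j n
    by (cases s; cases t) (auto simp: succ pred split: if_splits dest!: zdvd_imp_le)
  have "(\<Sum>i\<in>{0..<int n}. complex_of_real (connection (cycle_simplex n (j, s)) (cycle_simplex n (i, t))) * g i)
      = (\<Sum>i\<in>{i \<in> {0..<int n}. cycle_simplex n (j, s) \<inter> cycle_simplex n (i, t) \<noteq> {}}. g i)"
    by (subst sum.inter_filter) (auto simp: connection_def intro!: sum.cong)
  then have "(\<Sum>i\<in>{0..<int n}. complex_of_real (connection (cycle_simplex n (j, s)) (cycle_simplex n (i, t))) * g i)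
      = (\<Sum>i\<in>N. g i)"
    unfolding N .
  moreover have "(j - 1) mod int n \<noteq> (j + 1) mod int n" "(j - 1) mod int n \<noteq> j" "j \<noteq> (j + 1) mod int n"
    using j n by (auto simp: succ pred split: if_splits)
  ultimately show ?thesis by (auto simp: N_def per)
qed

lemma sum_torus_index:
  "(\<Sum>x\<in>torus_index n. f x) = (\<Sum>j\<in>{0..<int n}. \<Sum>s\<in>UNIV. f (j, s))"
  by (simp add: torus_index_def sum.cartesian_product)

text \<open>
  The Fourier transform in the position \<open>j\<close> reduces the eigenvector equation to the one for the
  symbol; orthogonality of the characters together with \<open>symbol_mode_involution\<close> gives the left
  inverse.
\<close>

lemma cycle_diagonalises:
  assumes n: "n \<ge> 3"
  shows "diagonalises (torus_index n) (\<lambda>x y. connection (cycle_simplex n x) (cycle_simplex n y))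
     (torus_index n) (\<lambda>(m, t). branch (freq n m) t) (cycle_mode n) (cycle_dual_mode n)"
  unfolding diagonalises_def
proof (intro conjI ballI)
  fix c c' :: "int \<times> bool" assume c: "c \<in> torus_index n" "c' \<in> torus_index n"
  obtain m t m' t' where eq: "c = (m, t)" "c' = (m', t')" by fastforce
  from c have m: "m \<in> {0..<int n}" "m' \<in> {0..<int n}" by (auto simp: torus_index_def eq)
  have "(\<Sum>x\<in>torus_index n. cycle_dual_mode n (m, t) x * cycle_mode n x (m', t'))
      = (\<Sum>j\<in>{0..<int n}. \<Sum>s\<in>UNIV.
          (cis (- (freq n m * of_int j)) * cis (freq n m' * of_int j)) *
          (symbol_mode (freq n m) t s * symbol_mode (freq n m') s t' / of_real (real n * symbol_norm (freq n m))))"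
    unfolding sum_torus_index cycle_mode_def cycle_dual_mode_def
    by (simp add: mult_ac)
  also have "\<dots> = (\<Sum>j\<in>{0..<int n}. cis (- (freq n m * of_int j)) * cis (freq n m' * of_int j)) *
      ((\<Sum>s\<in>UNIV. symbol_mode (freq n m) t s * symbol_mode (freq n m') s t') / of_real (real n * symbol_norm (freq n m)))"
    by (simp add: sum_product sum_divide_distrib)
  also have "\<dots> = of_bool ((m, t) = (m', t'))"
  proof (cases "m = m'")
    case True
    have "symbol_norm (freq n m') \<noteq> 0" using symbol_norm_pos by (metis less_irrefl)
    then show ?thesis
      using True cis_freq_orthogonal[OF _ m] symbol_mode_involution[of "freq n m'" t t'] n by auto
  next
    case False
    then show ?thesis using cis_freq_orthogonal[OF _ m] n by auto
  qed
  finally show "(\<Sum>x\<in>torus_index n. cycle_dual_mode n c x * cycle_mode n x c') = of_bool (c = c')"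
    unfolding eq .
next
  fix x c :: "int \<times> bool" assume x: "x \<in> torus_index n"
  obtain j s m t where eq: "x = (j, s)" "c = (m, t)" by fastforce
  from x have j: "j \<in> {0..<int n}" by (auto simp: torus_index_def eq)
  let ?\<theta> = "freq n m"
  define w where "w k = cis (?\<theta> * of_int k)" for k
  have w: "w (j + 1) = w j * cis ?\<theta>" "w (j - 1) = w j * cis (- ?\<theta>)"
    by (auto simp: w_def cis_mult algebra_simps)
  have per: "w (k mod int n) = w k" for k
    unfolding w_def using n by (intro cis_freq_period) auto
  have "(\<Sum>y\<in>torus_index n. complex_of_real (connection (cycle_simplex n (j, s)) (cycle_simplex n y)) * cycle_mode n y (m, t))
     = (\<Sum>a\<in>UNIV. (\<Sum>i\<in>{0..<int n}. complex_of_real (connection (cycle_simplex n (j, s)) (cycle_simplex n (i, a))) * w i) * symbol_mode ?\<theta> a t)"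
    unfolding sum_torus_index sum_distrib_right
    by (subst sum.swap) (simp add: cycle_mode_def w_def mult_ac)
  also have "\<dots> = w j * (if s then (1 + cis ?\<theta>) * symbol_mode ?\<theta> False t + (1 + cis ?\<theta> + cis (- ?\<theta>)) * symbol_mode ?\<theta> True t
      else symbol_mode ?\<theta> False t + (1 + cis (- ?\<theta>)) * symbol_mode ?\<theta> True t)"
    by (simp only: sum_cycle_connection[OF n j, of w, OF per]) (simp only: w, simp add: UNIV_bool algebra_simps)
  also have "\<dots> = w j * (of_real (branch ?\<theta> t) * symbol_mode ?\<theta> s t)"
    by (simp add: symbol_mode_vertex symbol_mode_edge)
  finally show "(\<Sum>y\<in>torus_index n. complex_of_real (connection (cycle_simplex n x) (cycle_simplex n y)) * cycle_mode n y c)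
     = complex_of_real (case c of (m, t) \<Rightarrow> branch (freq n m) t) * cycle_mode n x c"
    unfolding eq by (simp add: cycle_mode_def w_def mult_ac)
qed

lemma cycle_simplex_bij:
  assumes n: "n \<ge> 3"
  shows "bij_betw (cycle_simplex n) (torus_index n) (cycle_complex n)"
proof (rule bij_betwI')
  fix x y assume "x \<in> torus_index n" "y \<in> torus_index n"
  then obtain i s j t where eq: "x = (i, s)" "y = (j, t)"
    and i: "0 \<le> i" "i < int n" and j: "0 \<le> j" "j < int n"
    by (auto simp: torus_index_def)
  define i' j' where "i' = (i + 1) mod int n" and "j' = (j + 1) mod int n"
  have i': "i' = (if i + 1 = int n then 0 else i + 1)"
    using i by (cases "i + 1 = int n") (simp_all add: i'_def mod_pos_pos_trivial)
  have j': "j' = (if j + 1 = int n then 0 else j + 1)"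
    using j by (cases "j + 1 = int n") (simp_all add: j'_def mod_pos_pos_trivial)
  have same: "i = j \<Longrightarrow> i' = j'" by (simp add: i'_def j'_def)
  \<comment> \<open>Two edges with the same end points in opposite order exist only on the cycle of length 2.\<close>
  have edge: "i \<noteq> i'" "j \<noteq> j'" "\<not> (i = j' \<and> i' = j)"
    using i j n unfolding i' j' by (auto split: if_splits)
  show "(cycle_simplex n x = cycle_simplex n y) = (x = y)"
    unfolding eq cycle_simplex_def prod.case i'_def[symmetric] j'_def[symmetric]
    using edge same by (cases s; cases t) (auto simp: doubleton_eq_iff)
next
  fix x assume "x \<in> torus_index n"
  then obtain j s where "x = (j, s)" "j \<in> {0..<int n}"
    unfolding torus_index_def by blast
  then show "cycle_simplex n x \<in> cycle_complex n"
    unfolding cycle_simplex_def cycle_complex_def by (cases s) (simp_all only: prod.case if_True if_False, blast+)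
next
  fix y assume "y \<in> cycle_complex n"
  then consider j where "j \<in> {0..<int n}" "y = {j}" | j where "j \<in> {0..<int n}" "y = {j, (j + 1) mod int n}"
    unfolding cycle_complex_def by blast
  then show "\<exists>x\<in>torus_index n. y = cycle_simplex n x"
  proof cases
    case 1
    then show ?thesis by (intro bexI[of _ "(j, False)"]) (simp_all add: cycle_simplex_def torus_index_def)
  next
    case 2
    then show ?thesis by (intro bexI[of _ "(j, True)"]) (simp_all add: cycle_simplex_def torus_index_def)
  qed
qed

section \<open>Products of complexes\<close>

lemma Pi_UNIV_Int: "Pi UNIV A \<inter> Pi UNIV B \<noteq> {} \<longleftrightarrow> (\<forall>k. A k \<inter> B k \<noteq> {})"
proof
  assume "\<forall>k. A k \<inter> B k \<noteq> {}"
  then have "\<forall>k. \<exists>a. a \<in> A k \<inter> B k" by blast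
  then obtain f where "\<forall>k. f k \<in> A k \<inter> B k" by metis
  then show "Pi UNIV A \<inter> Pi UNIV B \<noteq> {}" by (auto simp: Pi_def)
qed (auto simp: Pi_def)

lemma of_bool_all: "of_bool (\<forall>k. P k) = (\<Prod>k\<in>(UNIV :: 'v::finite set). of_bool (P k) :: 'a::{comm_semiring_1})"
proof (cases "\<forall>k. P k")
  case False
  then have "(\<Prod>k\<in>(UNIV :: 'v set). of_bool (P k) :: 'a) = 0"
    by (intro prod_zero) auto
  then show ?thesis using False by simp
qed simp

text \<open>
  This identity makes the connection Laplacian of a product the tensor product of the connection
  Laplacians of the factors.
\<close>

lemma connection_Pi:
  "connection (Pi UNIV A) (Pi UNIV B) = (\<Prod>k\<in>(UNIV :: 'v::finite set). connection (A k) (B k) :: 'a::{comm_semiring_1})"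
  unfolding connection_def Pi_UNIV_Int by (rule of_bool_all)

lemma product_cells_bij:
  fixes \<sigma> :: "'x \<Rightarrow> int set"
  assumes bij: "bij_betw \<sigma> X K" and ne: "{} \<notin> K"
  shows "bij_betw (\<lambda>x. Pi UNIV (\<lambda>k. \<sigma> (x k))) {x :: 'v::finite \<Rightarrow> 'x. \<forall>k. x k \<in> X} (product_cells K)"
proof (rule bij_betwI')
  fix x y :: "'v \<Rightarrow> 'x" assume x: "x \<in> {x. \<forall>k. x k \<in> X}" and y: "y \<in> {x. \<forall>k. x k \<in> X}"
  have mem: "\<sigma> (x k) \<in> K" "\<sigma> (y k) \<in> K" for k using x y bij by (auto simp: bij_betw_def)
  have ne': "\<sigma> (x k) \<noteq> {}" "\<sigma> (y k) \<noteq> {}" for k using mem ne by metis+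
  have "x = y" if eq: "Pi UNIV (\<lambda>k. \<sigma> (x k)) = Pi UNIV (\<lambda>k. \<sigma> (y k))"
  proof
    fix k
    have "PiE UNIV (\<lambda>k. \<sigma> (x k)) = PiE UNIV (\<lambda>k. \<sigma> (y k))" using eq by (simp add: PiE_def)
    then have "\<sigma> (x k) = \<sigma> (y k)" by (subst (asm) PiE_eq_iff_not_empty) (use ne' in auto)
    then show "x k = y k" using bij x y by (auto simp: bij_betw_def inj_on_def)
  qed
  then show "(Pi UNIV (\<lambda>k. \<sigma> (x k)) = Pi UNIV (\<lambda>k. \<sigma> (y k))) = (x = y)" by auto
next
  fix x :: "'v \<Rightarrow> 'x" assume "x \<in> {x. \<forall>k. x k \<in> X}"
  then show "Pi UNIV (\<lambda>k. \<sigma> (x k)) \<in> product_cells K"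
    using bij by (auto simp: product_cells_def bij_betw_def)
next
  fix z :: "('v \<Rightarrow> int) set" assume "z \<in> product_cells K"
  then obtain u where u: "z = Pi UNIV u" "\<forall>k. u k \<in> K" unfolding product_cells_def by auto
  then have "\<forall>k. \<exists>a\<in>X. u k = \<sigma> a" using bij unfolding bij_betw_def by blast
  then obtain x where "\<forall>k. x k \<in> X \<and> u k = \<sigma> (x k)" by metis
  then show "\<exists>x\<in>{x. \<forall>k. x k \<in> X}. z = Pi UNIV (\<lambda>k. \<sigma> (x k))"
    unfolding u(1) by (intro bexI[of _ x]) auto
qed

section \<open>The eigenvalues of the torus\<close>

text \<open>
  The two branches over one full period each, the larger one over the left half of the unit interval
  and the smaller one over the right half. The angle \<open>4\<pi>x\<close> runs once around the circle on each half.
\<close>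

definition line_spectrum :: "real \<Rightarrow> real" where
  "line_spectrum x = branch (4 * pi * x) (x \<ge> 1 / 2)"

text \<open>
  The quotient of the index \<open>i\<close> by \<open>n\<close> selects the branch, the remainder is the frequency.
\<close>

lemma branch_freq_index:
  assumes n: "n > 0" and i: "i \<in> {0..<2 * int n}"
  shows "branch (freq n (i mod int n)) (i \<ge> int n) = line_spectrum (of_int i / real (2 * n))"
proof -
  have "real_of_int i / real (2 * n) \<ge> 1 / 2 \<longleftrightarrow> real_of_int i \<ge> real n"
    using n by (simp add: field_simps)
  also have "\<dots> \<longleftrightarrow> i \<ge> int n" by linarith
  finally have half: "real_of_int i / real (2 * n) \<ge> 1 / 2 \<longleftrightarrow> i \<ge> int n" .
  have "real_of_int i = of_int (i mod int n) + real n * of_int (i div int n)"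
    by (metis mod_mult_div_eq of_int_add of_int_mult of_int_of_nat_eq)
  then have "4 * pi * (of_int i / real (2 * n)) = freq n (i mod int n) + 2 * pi * of_int (i div int n)"
    using n by (simp add: freq_def field_simps)
  then have "cos (4 * pi * (of_int i / real (2 * n))) = cos (freq n (i mod int n))"
    by (simp add: cos_add)
  then show ?thesis
    unfolding line_spectrum_def branch_def half by simp
qed

lemma torus_index_inj:
  "inj_on (\<lambda>i. (i mod int n, i \<ge> int n)) {0..<2 * int n}"
  "(\<lambda>i. (i mod int n, i \<ge> int n)) ` {0..<2 * int n} \<subseteq> torus_index n"
proof -
  have m: "i mod int n = (if i \<ge> int n then i - int n else i)" if "i \<in> {0..<2 * int n}" for i
  proof (cases "i \<ge> int n")
    case True
    then have "i mod int n = (i - int n) mod int n" by simp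
    also have "\<dots> = i - int n" using True that by (intro mod_pos_pos_trivial) auto
    finally show ?thesis using True by simp
  qed (use that in auto)
  show "inj_on (\<lambda>i. (i mod int n, i \<ge> int n)) {0..<2 * int n}"
    by (rule inj_onI) (auto simp: m split: if_splits)
  show "(\<lambda>i. (i mod int n, i \<ge> int n)) ` {0..<2 * int n} \<subseteq> torus_index n"
    by (auto simp: torus_index_def)
qed

text \<open>
  The labels of the eigenvalues of the torus; in contrast to the pairs used for the cycle, they are
  the numerators of equidistant points in the unit cube.
\<close>

definition grid :: "nat \<Rightarrow> ('v::finite \<Rightarrow> int) set" where
  "grid n = {c. \<forall>k. c k \<in> {0..<2 * int n}}"

lemma grid_PiE: "grid n = (PiE UNIV (\<lambda>_. {0..<2 * int n}) :: ('v::finite \<Rightarrow> int) set)"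
  by (auto simp: grid_def PiE_def)

lemma finite_grid: "finite (grid n :: ('v::finite \<Rightarrow> int) set)"
  unfolding grid_PiE by (intro finite_PiE) auto

lemma card_grid: "card (grid n :: ('v::finite \<Rightarrow> int) set) = (2 * n) ^ CARD('v)"
  unfolding grid_PiE by (subst card_PiE) (auto simp: nat_mult_distrib)

lemma emeasure_torus_dk:
  assumes n: "n \<ge> 3" and B: "B \<in> sets borel"
  shows "emeasure (torus_dk TYPE('v::finite) n) B =
    ennreal (card {c \<in> grid n :: ('v \<Rightarrow> int) set. (\<Prod>k\<in>UNIV. line_spectrum (of_int (c k) / real (2 * n))) \<in> B}
      / (2 * real n) ^ CARD('v))"
proof -
  let ?X = "{x :: 'v \<Rightarrow> int \<times> bool. \<forall>k. x k \<in> torus_index n}"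
  let ?cell = "\<lambda>x :: 'v \<Rightarrow> int \<times> bool. Pi UNIV (\<lambda>k. cycle_simplex n (x k))"
  let ?Y = "product_cells (cycle_complex n) :: ('v \<Rightarrow> int) set set"
  let ?G = "grid n :: ('v \<Rightarrow> int) set"
  let ?eig = "\<lambda>c :: 'v \<Rightarrow> int. \<Prod>k\<in>UNIV. line_spectrum (of_int (c k) / real (2 * n))"
  have ne: "{} \<notin> cycle_complex n" by (auto simp: cycle_complex_def)
  have bij: "bij_betw ?cell ?X ?Y"
    by (rule product_cells_bij[OF cycle_simplex_bij[OF n] ne])
  have X_PiE: "?X = PiE UNIV (\<lambda>_. torus_index n)" by (auto simp: PiE_def)
  have fin1: "finite (torus_index n)" by (simp add: torus_index_def)
  have cardX: "card ?X = (2 * n) ^ CARD('v)"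
    unfolding X_PiE by (subst card_PiE) (auto simp: torus_index_def)
  have finX: "finite ?X" unfolding X_PiE by (intro finite_PiE) (auto simp: fin1)
  note line = diagonalises_reindex_eigenvalues[OF cycle_diagonalises[OF n] torus_index_inj]
  have "\<exists>P Q. diagonalises ?X (\<lambda>x y. connection (?cell x) (?cell y)) ?G
      (\<lambda>c. \<Prod>k\<in>UNIV. branch (freq n (c k mod int n)) (c k \<ge> int n)) P Q"
    unfolding connection_Pi grid_def
    using diagonalises_tensor[OF line[unfolded prod.case] fin1, where ?'v = 'v] by (intro exI)
  then obtain P Q where "diagonalises ?X (\<lambda>x y. connection (?cell x) (?cell y)) ?G
      (\<lambda>c. \<Prod>k\<in>UNIV. branch (freq n (c k mod int n)) (c k \<ge> int n)) P Q"
    by (elim exE)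
  note d = diagonalises_reindex_cells[OF this bij]
  have cp: "char_poly (connection_matrix ?Y) =
      (\<Prod>c\<in>?G. [:- (\<Prod>k\<in>UNIV. branch (freq n (c k mod int n)) (c k \<ge> int n)), 1:])"
    using finX bij_betw_finite[OF bij] bij_betw_same_card[OF bij] cardX card_grid[where ?'v = 'v]
    by (intro char_poly_connection_matrix[OF d] finite_grid) simp_all
  also have "\<dots> = (\<Prod>c\<in>?G. [:- ?eig c, 1:])"
    using n by (intro prod.cong refl) (simp add: branch_freq_index grid_def)
  finally have cp: "char_poly (connection_matrix ?Y) = (\<Prod>c\<in>?G. [:- ?eig c, 1:])" .
  have "connection_matrix ?Y \<in> carrier_mat (card ?Y) (card ?Y)"
    by (simp add: connection_matrix_def Let_def)
  note emeasure_eigenvalue_measure[OF this cp finite_grid _ B, of "1 / (2 * real n) ^ CARD('v)"]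
  moreover have "0 \<le> 1 / (2 * real n) ^ CARD('v)" by simp
  ultimately show ?thesis
    unfolding torus_dk_def by (simp only: times_divide_eq_left mult_1_left)
qed

section \<open>The spectral function of the line\<close>

text \<open>
  The product of the two branches is \<open>-1\<close> and the larger one is at most \<open>5\<close>, since \<open>1 + cos \<theta>\<close> is
  at most \<open>2\<close>.
\<close>

lemma line_spectrum_bounds: "1 / 5 \<le> \<bar>line_spectrum x\<bar>"
proof -
  define c where "c = 1 + cos (4 * pi * x)"
  define r where "r = sqrt (c\<^sup>2 + 1)"
  have c: "0 \<le> c" "c \<le> 2"
    using cos_ge_minus_one[of "4 * pi * x"] cos_le_one[of "4 * pi * x"] unfolding c_def by linarith+
  have r2: "r\<^sup>2 = c\<^sup>2 + 1" by (simp add: r_def)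
  have r: "1 \<le> r" "c \<le> r" by (auto simp: r_def intro: real_le_rsqrt)
  have "r \<le> c + 1"
  proof (rule power2_le_imp_le)
    show "r\<^sup>2 \<le> (c + 1)\<^sup>2" using c r2 by (simp add: power2_eq_square algebra_simps)
  qed (use c in auto)
  then have "r + c \<le> 5" using c by linarith
  moreover have prod: "(r - c) * (r + c) = 1" using r2 by (simp add: power2_eq_square algebra_simps)
  ultimately have "1 \<le> (r - c) * 5"
    using r(2) mult_left_mono[of "r + c" 5 "r - c"] by simp
  then show ?thesis
    using c r unfolding line_spectrum_def branch_def c_def[symmetric] r_def[symmetric] by auto
qed

lemma line_spectrum_nonzero: "line_spectrum x \<noteq> 0"
  using line_spectrum_bounds[of x] by auto

text \<open>
  Subtracting from an eigenvalue its inverse gives the trace of the symbol, as the determinant is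
  \<open>-1\<close>. So the angle is determined by the eigenvalue up to sign and full turns.
\<close>

lemma line_spectrum_cos:
  "(line_spectrum x - 1 / line_spectrum x) / 2 - 1 = cos (4 * pi * x)"
proof -
  define c where "c = 1 + cos (4 * pi * x)"
  define e where "e = (if x \<ge> 1 / 2 then -1 else 1 :: real)"
  define r where "r = sqrt (c\<^sup>2 + 1)"
  have e: "e * e = 1" by (simp add: e_def)
  have ls: "line_spectrum x = c + e * r"
    by (simp add: line_spectrum_def branch_def c_def r_def e_def)
  have "(e * r) * (e * r) = c\<^sup>2 + 1" using e by (simp add: r_def algebra_simps)
  then have "line_spectrum x * (c - e * r) = - 1"
    unfolding ls by (simp add: power2_eq_square algebra_simps)
  then have "- 1 / line_spectrum x = c - e * r"
    using line_spectrum_nonzero[of x] by (simp add: field_simps)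
  then have "line_spectrum x - 1 / line_spectrum x = 2 * c"
    using ls by simp
  then show ?thesis by (simp add: c_def add_divide_distrib)
qed

lemma borel_measurable_line_spectrum [measurable]: "line_spectrum \<in> borel_measurable borel"
  unfolding line_spectrum_def branch_def by measurable

text \<open>
  Solving \<open>line_spectrum_cos\<close> for \<open>x\<close> shows that, apart from the countably many points where the
  cosine is \<open>\<plusminus>1\<close>, the preimage is covered by countably many images of \<open>N\<close> under differentiable
  functions. Such images are negligible.
\<close>

lemma negligible_line_spectrum_vimage:
  assumes N: "negligible N"
  shows "negligible {x. line_spectrum x \<in> N}"
proof -
  define h :: "real \<Rightarrow> real" where "h l = (l - 1 / l) / 2 - 1" for l
  \<comment> \<open>On \<open>N'\<close> the derivative of the arc cosine exists.\<close>
  define N' where "N' = {l \<in> N. l \<noteq> 0 \<and> -1 < h l \<and> h l < 1}"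
  define g where "g = (\<lambda>(k :: int, s :: bool) l. ((if s then 1 else -1) * arccos (h l) + 2 * pi * of_int k) / (4 * pi))"
  have "negligible (g p ` N')" for p
  proof (rule negligible_differentiable_image_negligible[OF order_refl])
    show "negligible N'" by (rule negligible_subset[OF N]) (auto simp: N'_def)
    show "g p differentiable_on N'"
      unfolding differentiable_on_def
    proof
      fix l assume l: "l \<in> N'"
      have h: "(h has_real_derivative (1 + 1 / l\<^sup>2) / 2) (at l within N')"
        unfolding h_def using l
        by (auto intro!: derivative_eq_intros simp: N'_def power2_eq_square field_simps)
      have "((\<lambda>l. arccos (h l)) has_real_derivative inverse (- sqrt (1 - (h l)\<^sup>2)) * ((1 + 1 / l\<^sup>2) / 2)) (at l within N')"
        using l by (intro DERIV_chain2[OF DERIV_arccos h]) (auto simp: N'_def)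
      then have "(\<lambda>l. arccos (h l)) differentiable (at l within N')"
        by (auto simp: real_differentiable_def)
      then show "g p differentiable (at l within N')"
        unfolding g_def by (cases p) (auto intro!: derivative_intros)
    qed
  qed
  then have "negligible (\<Union>p. g p ` N')"
    by (intro negligible_countable_Union) auto
  moreover have "negligible (range (\<lambda>k :: int. of_int k / 4 :: real))"
    unfolding negligible_iff_null_sets
    by (intro null_sets_completionI countable_imp_null_set_lborel) auto
  ultimately have "negligible ((\<Union>p. g p ` N') \<union> range (\<lambda>k :: int. of_int k / 4))"
    by (rule negligible_Un)
  then show ?thesis
  proof (rule negligible_subset, intro subsetI)
    fix x assume "x \<in> {x. line_spectrum x \<in> N}"
    then have x: "line_spectrum x \<in> N" by simp
    have h: "h (line_spectrum x) = cos (4 * pi * x)"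
      unfolding h_def by (rule line_spectrum_cos)
    show "x \<in> (\<Union>p. g p ` N') \<union> range (\<lambda>k :: int. of_int k / 4)"
    proof (cases "\<bar>cos (4 * pi * x)\<bar> < 1")
      case True
      then have N': "line_spectrum x \<in> N'"
        using x h line_spectrum_nonzero[of x] by (auto simp: N'_def)
      have "cos (4 * pi * x) = cos (arccos (h (line_spectrum x)))"
        using True by (simp add: h)
      then obtain k :: int where "4 * pi * x = arccos (h (line_spectrum x)) + 2 * of_int k * pi \<or>
          4 * pi * x = - arccos (h (line_spectrum x)) + 2 * of_int k * pi"
        unfolding cos_eq by (auto elim!: Ints_cases)
      then have "x = g (k, True) (line_spectrum x) \<or> x = g (k, False) (line_spectrum x)"
        by (auto simp: g_def field_simps)
      then show ?thesis using N' by blast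
    next
      case False
      then have "\<bar>cos (4 * pi * x)\<bar> = 1" using abs_cos_le_one[of "4 * pi * x"] by linarith
      then have "sin (4 * pi * x) = 0"
        by (metis abs_square_eq_1 add_cancel_right_left power2_abs power_one sin_cos_squared_add zero_eq_power2)
      then obtain k :: int where "4 * pi * x = of_int k * pi"
        by (auto simp: sin_zero_iff_int2)
      then have "x = of_int k / 4" by (simp add: field_simps)
      then show ?thesis by blast
    qed
  qed
qed

section \<open>The limit law\<close>

text \<open>
  Restricting the space instead of the density makes every point of the probability space a point of
  the half-open interval, which is what rounding down to the grid needs.
\<close>

definition phase :: "real measure" where
  "phase = restrict_space lborel {0..<1}"

definition phases :: "('v::finite \<Rightarrow> real) measure" where
  "phases = PiM UNIV (\<lambda>_. phase)"

lemma space_phase [simp]: "space phase = {0..<1}"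
  by (simp add: phase_def space_restrict_space)

lemma emeasure_phase:
  assumes "A \<subseteq> {0..<1}" "A \<in> sets borel"
  shows "A \<in> sets phase" "emeasure phase A = emeasure lborel A"
  using assms by (auto simp: phase_def sets_restrict_space emeasure_restrict_space image_def)

interpretation phase: prob_space phase
  by (rule prob_spaceI) (simp add: emeasure_phase)

lemma prob_space_phases: "prob_space phases"
  unfolding phases_def by (rule prob_space_PiM) (rule phase.prob_space_axioms)

lemma space_phases: "space (phases :: ('v::finite \<Rightarrow> real) measure) = {x. \<forall>k. x k \<in> {0..<1}}"
  by (auto simp: phases_def space_PiM PiE_def)

lemma measurable_phase: "f \<in> borel_measurable borel \<Longrightarrow> f \<in> borel_measurable phase"
  unfolding phase_def by (rule measurable_restrict_space1) simp

lemma measurable_prod_phases: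
  fixes f :: "real \<Rightarrow> real"
  assumes "f \<in> borel_measurable borel"
  shows "(\<lambda>x. \<Prod>k\<in>UNIV. f (x k)) \<in> borel_measurable (phases :: ('v::finite \<Rightarrow> real) measure)"
  unfolding phases_def
proof (rule borel_measurable_prod)
  fix k :: 'v
  show "(\<lambda>x. f (x k)) \<in> borel_measurable (PiM UNIV (\<lambda>_. phase))"
    by (rule measurable_compose[OF _ measurable_phase[OF assms]]) (rule measurable_component_singleton, simp)
qed

definition limit_law :: "'v::finite itself \<Rightarrow> real measure" where
  "limit_law _ = distr (phases :: ('v \<Rightarrow> real) measure) borel (\<lambda>x. \<Prod>k\<in>UNIV. line_spectrum (x k))"

lemma real_distribution_phases:
  assumes "f \<in> borel_measurable (phases :: ('v::finite \<Rightarrow> real) measure)"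
  shows "real_distribution (distr phases borel f)"
proof -
  interpret prob_space "phases :: ('v \<Rightarrow> real) measure" by (rule prob_space_phases)
  show ?thesis using assms by (rule real_distribution_distr)
qed

lemma real_distribution_limit_law: "real_distribution (limit_law TYPE('v::finite))"
  unfolding limit_law_def
  by (intro real_distribution_phases measurable_prod_phases borel_measurable_line_spectrum)

text \<open>
  By Fubini it suffices to integrate over one coordinate with the others fixed. Their contribution
  is a constant factor \<open>C\<close>, nonzero because \<open>line_spectrum\<close> has no zeros, so a null set pulls back to
  a null set.
\<close>

lemma absolutely_continuous_limit_law:
  "absolutely_continuous lborel (limit_law TYPE('v::finite))"
  unfolding absolutely_continuous_def
proof
  fix N :: "real set" assume N: "N \<in> null_sets lborel"
  then have [measurable]: "N \<in> sets borel" by auto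
  let ?f = "\<lambda>x :: 'v \<Rightarrow> real. \<Prod>k\<in>UNIV. line_spectrum (x k)"
  \<comment> \<open>An arbitrary coordinate; it exists because types are nonempty.\<close>
  define i where "i = (undefined :: 'v)"
  define I where "I = UNIV - {i}"
  have UNIV: "UNIV = insert i I" and I: "finite I" "i \<notin> I" by (auto simp: I_def)
  interpret product_sigma_finite "\<lambda>_ :: 'v. phase" ..
  have f: "?f \<in> borel_measurable phases"
    by (rule measurable_prod_phases) measurable
  have "(\<lambda>x. indicator N (?f x) :: ennreal) \<in> borel_measurable phases"
    using f by (rule measurable_compose) measurable
  then have meas: "(\<lambda>x. indicator N (?f x) :: ennreal) \<in> borel_measurable (PiM (insert i I) (\<lambda>_. phase))"
    unfolding phases_def UNIV by simp
  have null: "emeasure phase {y \<in> {0..<1}. line_spectrum y * C \<in> N} = 0" if "C \<noteq> 0" for C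
  proof -
    have "negligible N"
      using N unfolding negligible_iff_null_sets by (rule null_sets_completionI)
    then have "negligible ((\<lambda>l. l / C) ` N)"
      by (intro negligible_differentiable_image_negligible) (auto intro!: derivative_intros that simp: differentiable_on_def)
    then have "negligible {y. line_spectrum y \<in> (\<lambda>l. l / C) ` N}"
      by (rule negligible_line_spectrum_vimage)
    then have neg: "negligible {y \<in> {0..<1}. line_spectrum y * C \<in> N}"
    proof (rule negligible_subset, intro subsetI)
      fix y assume "y \<in> {y \<in> {0..<1}. line_spectrum y * C \<in> N}"
      then have "line_spectrum y * C \<in> N" "line_spectrum y = (line_spectrum y * C) / C"
        using that by auto
      then show "y \<in> {y. line_spectrum y \<in> (\<lambda>l. l / C) ` N}" by blast
    qed
    have B: "{y \<in> {0..<1}. line_spectrum y * C \<in> N} \<in> sets borel" by measurable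
    have "{y \<in> {0..<1}. line_spectrum y * C \<in> N} \<in> null_sets lborel"
      using neg B unfolding negligible_iff_null_sets by (simp add: null_sets_completion_iff)
    then show ?thesis
      using B by (subst emeasure_phase(2)) auto
  qed
  have inner: "(\<integral>\<^sup>+ y. indicator N (?f (x(i := y))) \<partial>phase) = (0 :: ennreal)" for x
  proof -
    define C where "C = (\<Prod>k\<in>I. line_spectrum (x k))"
    have C: "C \<noteq> 0" unfolding C_def using I by (simp add: line_spectrum_nonzero)
    have B: "{y \<in> {0..<1}. line_spectrum y * C \<in> N} \<in> sets phase"
      by (rule emeasure_phase(1)) (auto, measurable)
    have "?f (x(i := y)) = line_spectrum y * C" for y
      unfolding UNIV using I by (simp add: C_def) (intro disjI2 prod.cong, auto)
    then have "(\<integral>\<^sup>+ y. indicator N (?f (x(i := y))) \<partial>phase)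
        = (\<integral>\<^sup>+ y. indicator {y \<in> {0..<1}. line_spectrum y * C \<in> N} y \<partial>phase)"
      by (intro nn_integral_cong) (auto simp: indicator_def)
    also have "\<dots> = 0"
      unfolding nn_integral_indicator[OF B] by (rule null[OF C])
    finally show ?thesis .
  qed
  have "emeasure (limit_law TYPE('v)) N = (\<integral>\<^sup>+ x. indicator N x \<partial>limit_law TYPE('v))"
    by (simp add: limit_law_def)
  also have "\<dots> = (\<integral>\<^sup>+ x. indicator N (?f x) \<partial>phases)"
    unfolding limit_law_def using f by (intro nn_integral_distr) auto
  also have "\<dots> = (\<integral>\<^sup>+ x. indicator N (?f x) \<partial>PiM (insert i I) (\<lambda>_. phase))"
    unfolding phases_def UNIV by simp
  also have "\<dots> = 0"
    unfolding product_nn_integral_insert[OF I meas] inner by simp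
  finally show "N \<in> null_sets (limit_law TYPE('v))"
    by (auto simp: limit_law_def)
qed

lemma measure_support_limit_law:
  "{-((1 / 5) ^ CARD('v))<..<(1 / 5) ^ CARD('v)} \<inter> measure_support (limit_law TYPE('v::finite)) = {}"
proof -
  let ?U = "{-((1 / 5) ^ CARD('v))<..<(1 / 5 :: real) ^ CARD('v)}"
  let ?f = "\<lambda>x :: 'v \<Rightarrow> real. \<Prod>k\<in>UNIV. line_spectrum (x k)"
  have "(1 / 5) ^ CARD('v) \<le> \<bar>?f x\<bar>" for x
    unfolding abs_prod
    using prod_mono[of UNIV "\<lambda>_ :: 'v. 1 / 5" "\<lambda>k. \<bar>line_spectrum (x k)\<bar>"] line_spectrum_bounds by simp
  then have "?f x \<notin> ?U" for x by (metis abs_less_iff greaterThanLessThan_iff leD minus_less_iff)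
  then have "?f -` ?U \<inter> space phases = {}" by blast
  moreover have "?f \<in> borel_measurable phases"
    by (rule measurable_prod_phases) measurable
  ultimately have "emeasure (limit_law TYPE('v)) ?U = 0"
    unfolding limit_law_def by (subst emeasure_distr) auto
  moreover have "open ?U" by simp
  ultimately show ?thesis
    unfolding measure_support_def by fastforce
qed

definition grid_point :: "nat \<Rightarrow> real \<Rightarrow> real" where
  "grid_point n t = of_int \<lfloor>2 * real n * t\<rfloor> / real (2 * n)"

lemma line_spectrum_grid_point_measurable:
  "(\<lambda>x. \<Prod>k\<in>UNIV. line_spectrum (grid_point n (x k))) \<in> borel_measurable (phases :: ('v::finite \<Rightarrow> real) measure)"
proof (rule measurable_prod_phases)
  show "(\<lambda>t. line_spectrum (grid_point n t)) \<in> borel_measurable borel"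
    unfolding grid_point_def by measurable
qed

text \<open>
  The points of the interval that are rounded down to \<open>c/(2n)\<close>.
\<close>

lemma floor_fibre:
  assumes n: "n > 0" and c: "c \<in> {0..<2 * int n}"
  shows "{t \<in> {0..<1}. \<lfloor>2 * real n * t\<rfloor> = c} \<in> sets phase"
    "emeasure phase {t \<in> {0..<1}. \<lfloor>2 * real n * t\<rfloor> = c} = ennreal (1 / (2 * real n))"
proof -
  let ?a = "of_int c / (2 * real n)" and ?b = "(of_int c + 1) / (2 * real n)"
  have "real_of_int c + 1 \<le> 2 * real n" using c by auto
  then have b: "?b \<le> 1" using n by (simp add: field_simps)
  have a: "0 \<le> ?a" using c by simp
  have iff: "\<lfloor>2 * real n * t\<rfloor> = c \<longleftrightarrow> t \<in> {?a..<?b}" for t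
    using n unfolding floor_eq_iff
    by (simp add: pos_divide_le_eq pos_less_divide_eq mult.commute)
  have sub: "{?a..<?b} \<subseteq> {0..<1}"
    using order_trans[OF a] less_le_trans[OF _ b] by (auto simp only: atLeastLessThan_iff)
  then have eq: "{t \<in> {0..<1}. \<lfloor>2 * real n * t\<rfloor> = c} = {?a..<?b}"
    unfolding iff by blast
  show "{t \<in> {0..<1}. \<lfloor>2 * real n * t\<rfloor> = c} \<in> sets phase"
    unfolding eq by (rule emeasure_phase(1)[OF sub]) simp
  have "?b - ?a = 1 / (2 * real n)" by (simp add: add_divide_distrib)
  moreover have "?a \<le> ?b" by (simp add: divide_right_mono)
  ultimately show "emeasure phase {t \<in> {0..<1}. \<lfloor>2 * real n * t\<rfloor> = c} = ennreal (1 / (2 * real n))"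
    unfolding eq by (subst emeasure_phase(2)[OF sub]) simp_all
qed

text \<open>
  Rounding the coordinates down to the grid maps the uniform distribution on the cube to the uniform
  distribution on the grid, whose points label the eigenvalues.
\<close>

lemma torus_dk_eq_distr:
  assumes n: "n \<ge> 3"
  shows "torus_dk TYPE('v::finite) n =
    distr (phases :: ('v \<Rightarrow> real) measure) borel (\<lambda>x. \<Prod>k\<in>UNIV. line_spectrum (grid_point n (x k)))"
    (is "_ = distr phases borel ?f")
proof (rule measure_eqI)
  show "sets (torus_dk TYPE('v) n) = sets (distr phases borel ?f)"
    by (simp add: torus_dk_def eigenvalue_measure_def)
  fix B assume "B \<in> sets (torus_dk TYPE('v) n)"
  then have B: "B \<in> sets borel" by (simp add: torus_dk_def eigenvalue_measure_def)
  define S where "S = {c \<in> grid n :: ('v \<Rightarrow> int) set. (\<Prod>k\<in>UNIV. line_spectrum (of_int (c k) / real (2 * n))) \<in> B}"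
  define A where "A c = PiE UNIV (\<lambda>k :: 'v. {t \<in> {0..<1}. \<lfloor>2 * real n * t\<rfloor> = c k})" for c
  interpret product_sigma_finite "\<lambda>_ :: 'v. phase" ..
  have n0: "n > 0" using n by simp
  have A: "A c \<in> sets phases" "emeasure phases (A c) = ennreal (1 / (2 * real n) ^ CARD('v))" if "c \<in> S" for c
  proof -
    have c: "c k \<in> {0..<2 * int n}" for k using that unfolding S_def grid_def by blast
    show "A c \<in> sets phases"
      unfolding A_def phases_def by (intro sets_PiM_I_finite floor_fibre n0 c) auto
    show "emeasure phases (A c) = ennreal (1 / (2 * real n) ^ CARD('v))"
      unfolding A_def phases_def
      by (subst emeasure_PiM) (simp_all only: floor_fibre[OF n0 c] finite_code prod_constant, simp add: ennreal_power power_one_over)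
  qed
  have "?f -` B \<inter> space phases = (\<Union>c\<in>S. A c)"
  proof (intro equalityI subsetI)
    fix x assume x: "x \<in> ?f -` B \<inter> space phases"
    define c where "c k = \<lfloor>2 * real n * x k\<rfloor>" for k
    have "0 \<le> x k" "x k < 1" for k using x by (auto simp: space_phases)
    then have "c k \<in> {0..<2 * int n}" for k
      using n0 by (auto simp: c_def floor_less_iff)
    moreover have "(\<Prod>k\<in>UNIV. line_spectrum (of_int (c k) / real (2 * n))) \<in> B"
      using x unfolding grid_point_def c_def by blast
    ultimately have "c \<in> S" unfolding S_def grid_def by blast
    moreover have "x \<in> A c" using x by (auto simp: A_def c_def space_phases PiE_def)
    ultimately show "x \<in> (\<Union>c\<in>S. A c)" by blast
  next
    fix x assume "x \<in> (\<Union>c\<in>S. A c)"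
    then obtain c where c: "c \<in> S" "x \<in> A c" by blast
    then have fl: "\<lfloor>2 * real n * x k\<rfloor> = c k" "x k \<in> {0..<1}" for k
      by (auto simp: A_def PiE_def Pi_def)
    have "?f x \<in> B" using c(1) unfolding grid_point_def fl S_def by blast
    then show "x \<in> ?f -` B \<inter> space phases" using fl(2) by (simp add: space_phases)
  qed
  then have "emeasure (distr phases borel ?f) B = emeasure phases (\<Union>c\<in>S. A c)"
    using B line_spectrum_grid_point_measurable[of n] by (subst emeasure_distr) auto
  also have "\<dots> = (\<Sum>c\<in>S. emeasure phases (A c))"
  proof (rule sum_emeasure[symmetric])
    show "A ` S \<subseteq> sets phases" using A(1) by blast
    show "disjoint_family_on A S"
    proof (unfold disjoint_family_on_def, intro ballI impI)
      fix c d :: "'v \<Rightarrow> int" assume "c \<noteq> d"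
      then obtain k where "c k \<noteq> d k" by auto
      then show "A c \<inter> A d = {}" by (auto simp: A_def PiE_def Pi_def)
    qed
    show "finite S" unfolding S_def by (rule finite_subset[OF _ finite_grid]) auto
  qed
  also have "\<dots> = of_nat (card S) * ennreal (1 / (2 * real n) ^ CARD('v))"
    using A(2) by simp
  also have "\<dots> = ennreal (card S / (2 * real n) ^ CARD('v))"
    by (simp add: ennreal_of_nat_eq_real_of_nat flip: ennreal_mult)
  also have "\<dots> = emeasure (torus_dk TYPE('v) n) B"
    unfolding S_def by (rule emeasure_torus_dk[OF n B, symmetric])
  finally show "emeasure (torus_dk TYPE('v) n) B = emeasure (distr phases borel ?f) B" ..
qed

lemma grid_point_tendsto: "(\<lambda>n. grid_point n t) \<longlonglongrightarrow> t"
proof (rule tendsto_sandwich)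
  show "(\<lambda>n. t - 1 / (2 * real n)) \<longlonglongrightarrow> t" by real_asymp
  show "(\<lambda>n. t) \<longlonglongrightarrow> t" by simp
  show "\<forall>\<^sub>F n in sequentially. t - 1 / (2 * real n) \<le> grid_point n t"
    using eventually_gt_at_top[of 0]
  proof eventually_elim
    case (elim n)
    have "2 * real n * t - 1 \<le> of_int \<lfloor>2 * real n * t\<rfloor>" by linarith
    then have "(2 * real n * t - 1) / (2 * real n) \<le> of_int \<lfloor>2 * real n * t\<rfloor> / (2 * real n)"
      by (intro divide_right_mono) auto
    then show ?case using elim by (simp add: grid_point_def diff_divide_distrib)
  qed
  show "\<forall>\<^sub>F n in sequentially. grid_point n t \<le> t"
    using eventually_gt_at_top[of 0]
  proof eventually_elim
    case (elim n)
    have "of_int \<lfloor>2 * real n * t\<rfloor> / (2 * real n) \<le> (2 * real n * t) / (2 * real n)"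
      by (intro divide_right_mono) auto
    then show ?case using elim by (simp add: grid_point_def)
  qed
qed

text \<open>
  Rounding down never crosses the discontinuity at \<open>1/2\<close>, because \<open>1/2\<close> is itself a grid point; so the
  convergence holds at every point.
\<close>

lemma line_spectrum_grid_point_tendsto: "(\<lambda>n. line_spectrum (grid_point n t)) \<longlonglongrightarrow> line_spectrum t"
proof -
  have "\<forall>\<^sub>F n in sequentially. branch (4 * pi * grid_point n t) (t \<ge> 1 / 2) = line_spectrum (grid_point n t)"
    using eventually_gt_at_top[of 0]
  proof eventually_elim
    case (elim n)
    have "grid_point n t \<ge> 1 / 2 \<longleftrightarrow> of_int \<lfloor>2 * real n * t\<rfloor> \<ge> real n"
      using elim by (simp add: grid_point_def field_simps)
    also have "\<dots> \<longleftrightarrow> \<lfloor>2 * real n * t\<rfloor> \<ge> int n" by linarith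
    also have "\<dots> \<longleftrightarrow> t \<ge> 1 / 2"
      using elim by (simp add: le_floor_iff field_simps)
    finally show ?case by (simp add: line_spectrum_def)
  qed
  moreover have "(\<lambda>n. branch (4 * pi * grid_point n t) (t \<ge> 1 / 2)) \<longlonglongrightarrow> branch (4 * pi * t) (t \<ge> 1 / 2)"
    unfolding branch_def by (intro tendsto_intros grid_point_tendsto)
  ultimately show ?thesis
    unfolding line_spectrum_def[of t] by (rule Lim_transform_eventually[rotated])
qed

lemma weak_conv_torus_dk:
  "weak_conv_m (\<lambda>n. torus_dk TYPE('v::finite) n) (limit_law TYPE('v))"
proof -
  let ?f = "\<lambda>n (x :: 'v \<Rightarrow> real). \<Prod>k\<in>UNIV. line_spectrum (grid_point n (x k))"
  let ?g = "\<lambda>x :: 'v \<Rightarrow> real. \<Prod>k\<in>UNIV. line_spectrum (x k)"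
  interpret prob_space "phases :: ('v \<Rightarrow> real) measure" by (rule prob_space_phases)
  have g [measurable]: "?g \<in> borel_measurable phases"
    by (rule measurable_prod_phases) measurable
  note f [measurable] = line_spectrum_grid_point_measurable[where ?'v = 'v]
  have "weak_conv_m (\<lambda>n. distr phases borel (?f n)) (limit_law TYPE('v))"
  proof (rule levy_continuity)
    show "real_distribution (distr phases borel (?f n))" for n
      by (rule real_distribution_phases) (rule f)
    show "real_distribution (limit_law TYPE('v))"
      by (rule real_distribution_limit_law)
    fix t
    have "(\<lambda>n. \<integral>x. iexp (t * ?f n x) \<partial>phases) \<longlonglongrightarrow> (\<integral>x. iexp (t * ?g x) \<partial>phases)"
    proof (rule integral_dominated_convergence[where w = "\<lambda>_. 1"])
      show "AE x in phases. (\<lambda>n. iexp (t * ?f n x)) \<longlonglongrightarrow> iexp (t * ?g x)"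
        by (intro AE_I2 tendsto_intros line_spectrum_grid_point_tendsto)
      show "AE x in phases. norm (iexp (t * ?f n x)) \<le> 1" for n
        unfolding norm_exp_i_times by simp
    qed measurable
    then show "(\<lambda>n. char (distr phases borel (?f n)) t) \<longlonglongrightarrow> char (limit_law TYPE('v)) t"
      unfolding char_def limit_law_def by (simp add: integral_distr)
  qed
  moreover have "\<forall>\<^sub>F n in sequentially. cdf (distr phases borel (?f n)) x = cdf (torus_dk TYPE('v) n) x" for x
    using eventually_ge_at_top[of 3] by eventually_elim (simp add: torus_dk_eq_distr)
  ultimately show ?thesis
    unfolding weak_conv_m_def weak_conv_def by (blast intro: Lim_transform_eventually)
qed

section \<open>The Laplacian of the lattice\<close>

text \<open>
  In the enumeration along the line, vertices are the even and edges the odd numbers.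
\<close>

lemma line_connection:
  "connection (line_simplex i) (line_simplex j) =
     (if even i then if even j then of_bool (i = j) else of_bool (\<bar>i - j\<bar> = 1)
      else if even j then of_bool (\<bar>i - j\<bar> = 1) else of_bool (\<bar>i - j\<bar> \<le> 2) :: 'a :: zero_neq_one)"
proof -
  have "line_simplex i \<inter> line_simplex j \<noteq> {} \<longleftrightarrow>
     (if even i then if even j then i = j else \<bar>i - j\<bar> = 1
      else if even j then \<bar>i - j\<bar> = 1 else \<bar>i - j\<bar> \<le> 2)"
  proof (cases "even i"; cases "even j")
    assume "even i" "even j"
    then show ?thesis by (auto simp: line_simplex_def elim!: evenE)
  next
    assume "even i" "odd j"
    then show ?thesis by (auto simp: line_simplex_def elim!: evenE oddE)
  next
    assume "odd i" "even j"
    then show ?thesis by (auto simp: line_simplex_def elim!: evenE oddE)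
  next
    assume "odd i" "odd j"
    then show ?thesis by (auto simp: line_simplex_def elim!: oddE)
  qed
  then show ?thesis unfolding connection_def by simp
qed

text \<open>
  The inverse of the Laplacian of the line. Since the determinant of the symbol is \<open>-1\<close>, the inverse
  symbol is minus the adjugate matrix; this exchanges the roles of vertices and edges, whence the
  shift by one, and changes the sign of the entries between simplices of equal dimension.
\<close>

definition line_green :: "int \<Rightarrow> int \<Rightarrow> complex" where
  "line_green i j = (if even (i + j) then - 1 else 1) * connection (line_simplex (i + 1)) (line_simplex (j + 1))"

lemma line_green_eq:
  "line_green i j =
     (if even i then if even j then - of_bool (\<bar>i - j\<bar> \<le> 2) else of_bool (\<bar>i - j\<bar> = 1)
      else if even j then of_bool (\<bar>i - j\<bar> = 1) else - of_bool (i = j))"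
  unfolding line_green_def line_connection by (simp add: abs_if)

lemma int_window: "{i - 2..i + 2} = {i - 2, i - 1, i, i + 1, i + 2 :: int}"
  by auto

text \<open>
  Once the parities of \<open>i\<close> and \<open>l\<close> are fixed, every term is plus or minus an indicator of a condition on
  \<open>i - l\<close>, and these cancel off the diagonal.
\<close>

lemma line_green_connection:
  "(\<Sum>j\<in>{i - 2..i + 2}. line_green i j * connection (line_simplex j) (line_simplex l)) = of_bool (i = l)"
proof -
  have "(\<Sum>j\<in>{i - 2..i + 2}. f j) = f (i - 2) + f (i - 1) + f i + f (i + 1) + f (i + 2)" for f :: "int \<Rightarrow> complex"
    unfolding int_window by (simp add: add.assoc)
  then show ?thesis
    by (cases "even i"; cases "even l") (simp_all add: line_green_eq line_connection, presburger+)
qed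

lemma line_connection_green:
  "(\<Sum>j\<in>{i - 2..i + 2}. connection (line_simplex i) (line_simplex j) * line_green j l) = of_bool (i = l)"
proof -
  have "(\<Sum>j\<in>{i - 2..i + 2}. f j) = f (i - 2) + f (i - 1) + f i + f (i + 1) + f (i + 2)" for f :: "int \<Rightarrow> complex"
    unfolding int_window by (simp add: add.assoc)
  then show ?thesis
    by (cases "even i"; cases "even l") (simp_all add: line_green_eq line_connection, presburger+)
qed

lemma line_simplex_bij: "bij_betw line_simplex UNIV line_complex"
proof (rule bij_betwI')
  fix i j
  have "i = j" if "line_simplex i = line_simplex j"
  proof -
    have "card (line_simplex i) = card (line_simplex j)" using that by simp
    then have p: "even i = even j" by (auto simp: line_simplex_def split: if_splits)
    then have "i div 2 = j div 2"
      using that by (auto simp: line_simplex_def doubleton_eq_iff split: if_splits)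
    with p show "i = j" by (metis even_iff_mod_2_eq_zero mult_div_mod_eq not_mod_2_eq_1_eq_0)
  qed
  then show "(line_simplex i = line_simplex j) = (i = j)" by auto
next
  fix i :: int
  show "line_simplex i \<in> line_complex"
    unfolding line_simplex_def line_complex_def by (cases "even i") (simp_all only: if_True if_False, blast+)
next
  fix y assume "y \<in> line_complex"
  then consider j where "y = {j}" | j where "y = {j, j + 1}" unfolding line_complex_def by blast
  then show "\<exists>i\<in>UNIV. y = line_simplex i"
  proof cases
    case 1
    then show ?thesis by (intro bexI[of _ "2 * j"]) (simp_all add: line_simplex_def)
  next
    case 2
    then show ?thesis by (intro bexI[of _ "2 * j + 1"]) (simp_all add: line_simplex_def)
  qed
qed

abbreviation lattice_cells :: "('v::finite \<Rightarrow> int) set set" where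
  "lattice_cells \<equiv> product_cells line_complex"

lemma lattice_cell_bij: "bij_betw lattice_cell UNIV (lattice_cells :: ('v::finite \<Rightarrow> int) set set)"
proof -
  have "{} \<notin> line_complex" unfolding line_complex_def by blast
  from product_cells_bij[OF line_simplex_bij this, where ?'v = 'v]
  have "bij_betw (\<lambda>x :: 'v \<Rightarrow> int. Pi UNIV (\<lambda>k. line_simplex (x k))) UNIV lattice_cells"
    by simp
  then show ?thesis unfolding lattice_cell_def[abs_def] .
qed

lemma lattice_entry_prod:
  "lattice_entry i j = (\<Prod>k\<in>UNIV. connection (line_simplex (i k)) (line_simplex (j k)))"
  unfolding lattice_entry_def lattice_cell_def by (rule connection_Pi)

definition lattice_green :: "('v::finite \<Rightarrow> int) \<Rightarrow> ('v \<Rightarrow> int) \<Rightarrow> complex" where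
  "lattice_green i j = (\<Prod>k\<in>UNIV. line_green (i k) (j k))"

definition window :: "int \<Rightarrow> ('v::finite \<Rightarrow> int) \<Rightarrow> ('v \<Rightarrow> int) set" where
  "window r i = PiE UNIV (\<lambda>k. {i k - r..i k + r})"

lemma window_iff: "j \<in> window r i \<longleftrightarrow> (\<forall>k. \<bar>j k - i k\<bar> \<le> r)"
  by (auto simp: window_def PiE_def Pi_def abs_le_iff) (smt (verit))+

lemma finite_window: "finite (window r i)"
  unfolding window_def by (intro finite_PiE) auto

lemma sum_window_prod:
  "(\<Sum>j\<in>window r i. (\<Prod>k\<in>UNIV. a k (j k)) * (\<Prod>k\<in>UNIV. b k (j k)))
     = (\<Prod>k\<in>UNIV. \<Sum>j\<in>{i k - r..i k + r}. a k j * b k j :: complex)"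
  unfolding window_def prod.distrib[symmetric]
  using prod_sum_PiE[of UNIV "\<lambda>k. {i k - r..i k + r}" "\<lambda>k j. a k j * b k j"] by simp

lemma of_bool_fun_eq: "(\<Prod>k\<in>UNIV. of_bool (i k = l k)) = (of_bool (i = l) :: complex)"
  for i :: "'v::finite \<Rightarrow> int"
  unfolding of_bool_all[symmetric] fun_eq_iff by simp

lemma lattice_green_entry: "(\<Sum>j\<in>window 2 i. lattice_green i j * lattice_entry j l) = of_bool (i = l)"
  unfolding lattice_green_def lattice_entry_prod
    sum_window_prod[of "\<lambda>k j. line_green (i k) j" "\<lambda>k j. connection (line_simplex j) (line_simplex (l k))" 2 i]
    line_green_connection by (rule of_bool_fun_eq)

lemma lattice_entry_green: "(\<Sum>j\<in>window 2 i. lattice_entry i j * lattice_green j l) = of_bool (i = l)"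
  unfolding lattice_green_def lattice_entry_prod
    sum_window_prod[of "\<lambda>k j. connection (line_simplex (i k)) (line_simplex j)" "\<lambda>k j. line_green j (l k)" 2 i]
    line_connection_green by (rule of_bool_fun_eq)

text \<open>
  The radius \<open>2\<close> is the largest distance at which two simplices of the line meet: it is attained by
  neighbouring edges.
\<close>

definition finite_range :: "(('v::finite \<Rightarrow> int) \<Rightarrow> ('v \<Rightarrow> int) \<Rightarrow> complex) \<Rightarrow> bool" where
  "finite_range K \<longleftrightarrow> (\<forall>i j. cmod (K i j) \<le> 1) \<and> (\<forall>i j. j \<notin> window 2 i \<longrightarrow> K i j = 0)"

lemma finite_range_prod:
  assumes "\<And>i j. cmod (a i j) \<le> 1" "\<And>i j. \<bar>j - i\<bar> > 2 \<Longrightarrow> a i j = 0"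
  shows "finite_range (\<lambda>i j. \<Prod>k\<in>UNIV. a (i k) (j k))"
  unfolding finite_range_def
proof (intro conjI allI impI)
  fix i j :: "'a \<Rightarrow> int"
  show "cmod (\<Prod>k\<in>UNIV. a (i k) (j k)) \<le> 1"
    unfolding prod_norm[symmetric] using assms(1) by (intro prod_le_1) auto
  assume "j \<notin> window 2 i"
  then obtain k where "\<bar>j k - i k\<bar> > 2" by (auto simp: window_iff not_le)
  then have "a (i k) (j k) = 0" by (rule assms(2))
  then show "(\<Prod>k\<in>UNIV. a (i k) (j k)) = 0" by (intro prod_zero) auto
qed

lemma finite_range_lattice_entry: "finite_range lattice_entry"
proof -
  have "finite_range (\<lambda>i j :: 'a \<Rightarrow> int. \<Prod>k\<in>UNIV. connection (line_simplex (i k)) (line_simplex (j k)))"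
    by (rule finite_range_prod) (auto simp: line_connection)
  then show ?thesis by (simp add: lattice_entry_prod[abs_def])
qed

lemma finite_range_lattice_green: "finite_range lattice_green"
  unfolding lattice_green_def[abs_def]
  by (rule finite_range_prod) (auto simp: line_green_eq)

definition lattice_index :: "('v::finite \<Rightarrow> int) set \<Rightarrow> 'v \<Rightarrow> int" where
  "lattice_index = inv_into UNIV lattice_cell"

lemma lattice_index_cell [simp]: "lattice_index (lattice_cell i) = i"
  unfolding lattice_index_def by (metis bij_betw_def inv_f_f lattice_cell_bij)

lemma lattice_cell_in [simp]: "lattice_cell i \<in> lattice_cells"
  using lattice_cell_bij by (auto simp: bij_betw_def)

lemma lattice_cellsE:
  assumes "x \<in> lattice_cells"
  obtains i where "x = lattice_cell i"
  using assms lattice_cell_bij by (auto simp: bij_betw_def)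

text \<open>
  The kernel acts on the index lattice and is transported to the cells along \<open>lattice_cell\<close>. Summing over
  a finite window makes the operator total; for kernels of finite range nothing is cut off.
\<close>

definition kernel_operator ::
    "(('v::finite \<Rightarrow> int) \<Rightarrow> ('v \<Rightarrow> int) \<Rightarrow> complex) \<Rightarrow> (('v \<Rightarrow> int) set \<Rightarrow> complex) \<Rightarrow> ('v \<Rightarrow> int) set \<Rightarrow> complex" where
  "kernel_operator K f x =
     (if x \<in> lattice_cells
      then \<Sum>j\<in>window 2 (lattice_index x). K (lattice_index x) j * f (lattice_cell j) else 0)"

lemma kernel_operator_cell:
  "kernel_operator K f (lattice_cell i) = (\<Sum>j\<in>window 2 i. K i j * f (lattice_cell j))"
  by (simp add: kernel_operator_def)

text \<open>
  Sums over the windows around different centres can only be interchanged after extending them to a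
  common window; as \<open>j\<close> is within \<open>2\<close> of \<open>i\<close> and \<open>l\<close> within \<open>2\<close> of \<open>j\<close>, radius \<open>4\<close> suffices.
\<close>

lemma kernel_operator_inverse:
  assumes B: "finite_range B"
    and inv: "\<And>i l. (\<Sum>j\<in>window 2 i. A i j * B j l) = of_bool (i = l)"
    and f: "\<And>x. x \<notin> lattice_cells \<Longrightarrow> f x = 0"
  shows "kernel_operator A (kernel_operator B f) = f"
proof
  fix x
  show "kernel_operator A (kernel_operator B f) x = f x"
  proof (cases "x \<in> lattice_cells")
    case True
    then obtain i where x: "x = lattice_cell i" by (rule lattice_cellsE)
    have ext: "(\<Sum>l\<in>window 2 j. B j l * f (lattice_cell l)) = (\<Sum>l\<in>window 4 i. B j l * f (lattice_cell l))"
      if "j \<in> window 2 i" for j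
    proof (rule sum.mono_neutral_left)
      show "window 2 j \<subseteq> window 4 i"
      proof
        fix l assume "l \<in> window 2 j"
        then have near: "\<bar>l k - j k\<bar> \<le> 2" "\<bar>j k - i k\<bar> \<le> 2" for k
          using that by (auto simp: window_iff)
        have "\<bar>l k - i k\<bar> \<le> 4" for k using near[of k] by linarith
        then show "l \<in> window 4 i" by (simp add: window_iff)
      qed
      show "\<forall>l\<in>window 4 i - window 2 j. B j l * f (lattice_cell l) = 0"
        using B by (auto simp: finite_range_def)
    qed (rule finite_window)
    have "kernel_operator A (kernel_operator B f) x
        = (\<Sum>j\<in>window 2 i. A i j * (\<Sum>l\<in>window 4 i. B j l * f (lattice_cell l)))"
      unfolding x kernel_operator_cell by (intro sum.cong refl) (simp only: ext)
    also have "\<dots> = (\<Sum>l\<in>window 4 i. (\<Sum>j\<in>window 2 i. A i j * B j l) * f (lattice_cell l))"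
      unfolding sum_distrib_left sum_distrib_right mult.assoc[symmetric] by (rule sum.swap)
    also have "\<dots> = (\<Sum>l\<in>window 4 i. if l = i then f (lattice_cell l) else 0)"
      unfolding inv by (intro sum.cong) auto
    also have "\<dots> = f x"
      by (subst sum.delta[OF finite_window]) (simp add: x window_iff)
    finally show ?thesis .
  qed (simp add: f kernel_operator_def)
qed

lemma l2_lattice_iff:
  "f \<in> l2 lattice_cells \<longleftrightarrow>
     (\<forall>x. x \<notin> lattice_cells \<longrightarrow> f x = 0) \<and> (\<lambda>i. (cmod (f (lattice_cell i)))\<^sup>2) summable_on UNIV"
  unfolding l2_def using summable_on_reindex_bij_betw[OF lattice_cell_bij, of "\<lambda>x. (cmod (f x))\<^sup>2"] by simp

lemma l2_norm_lattice:
  "l2_norm lattice_cells f = sqrt (\<Sum>\<^sub>\<infinity>i. (cmod (f (lattice_cell i)))\<^sup>2)"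
  unfolding l2_norm_def using infsum_reindex_bij_betw[OF lattice_cell_bij, of "\<lambda>x. (cmod (f x))\<^sup>2"] by simp

lemma has_sum_sum_const:
  fixes g :: "'d \<Rightarrow> 'a \<Rightarrow> real"
  assumes "finite D" "\<And>d. ((\<lambda>i. g d i) has_sum S) A"
  shows "((\<lambda>i. \<Sum>d\<in>D. g d i) has_sum (\<Sum>d\<in>D. S)) A"
  using assms(1)
proof (induction D)
  case (insert d D)
  then show ?case using has_sum_add[OF assms(2) insert.IH] by (simp add: distrib_right)
qed simp

text \<open>
  By the inequality between the square of a sum and the sum of the squares, the squared norm of the
  image is at most the number of lattice vectors in the window times the sum of the squared norms of
  the translates of \<open>f\<close>, all of which agree with that of \<open>f\<close>.
\<close>

lemma bounded_kernel_operator: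
  fixes K :: "('v::finite \<Rightarrow> int) \<Rightarrow> ('v \<Rightarrow> int) \<Rightarrow> complex"
  assumes K: "finite_range K"
  shows "bounded_l2_operator lattice_cells (kernel_operator K)"
proof -
  let ?W = "window 2 (\<lambda>_. 0) :: ('v \<Rightarrow> int) set"
  define C where "C = real (card ?W)"
  have key: "kernel_operator K f \<in> l2 lattice_cells \<and> l2_norm lattice_cells (kernel_operator K f) \<le> C * l2_norm lattice_cells f"
    if f: "f \<in> l2 lattice_cells" for f
  proof -
    define u where "u i = cmod (f (lattice_cell i))" for i
    define S where "S = (\<Sum>\<^sub>\<infinity>i. (u i)\<^sup>2)"
    have u: "((\<lambda>i. (u i)\<^sup>2) has_sum S) UNIV"
      using f unfolding l2_lattice_iff u_def S_def by auto
    have bij: "bij (\<lambda>i :: 'v \<Rightarrow> int. (\<lambda>k. i k + d k))" for d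
      by (rule bij_betw_byWitness[where f' = "\<lambda>i k. i k - d k"]) auto
    have shift: "((\<lambda>i. (u (\<lambda>k. i k + d k))\<^sup>2) has_sum S) UNIV" for d
      using has_sum_reindex_bij_betw[OF bij, of "\<lambda>i. (u i)\<^sup>2"] u by blast
    have maj: "((\<lambda>i. C * (\<Sum>d\<in>?W. (u (\<lambda>k. i k + d k))\<^sup>2)) has_sum C * (\<Sum>d\<in>?W. S)) UNIV"
      by (intro has_sum_cmult_right has_sum_sum_const finite_window shift)
    have win: "(\<Sum>j\<in>window 2 i. h j) = (\<Sum>d\<in>?W. h (\<lambda>k. i k + d k))" for h :: "('v \<Rightarrow> int) \<Rightarrow> real" and i
      by (rule sum.reindex_bij_witness[where i = "\<lambda>d k. i k + d k" and j = "\<lambda>j k. j k - i k"])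
         (auto simp: window_iff)
    have le: "(cmod (kernel_operator K f (lattice_cell i)))\<^sup>2 \<le> C * (\<Sum>d\<in>?W. (u (\<lambda>k. i k + d k))\<^sup>2)" for i
    proof -
      have "cmod (kernel_operator K f (lattice_cell i)) \<le> (\<Sum>j\<in>window 2 i. cmod (K i j * f (lattice_cell j)))"
        unfolding kernel_operator_cell by (rule norm_sum)
      also have "\<dots> \<le> (\<Sum>j\<in>window 2 i. u j)"
        using K unfolding u_def finite_range_def
        by (intro sum_mono) (auto simp: norm_mult intro: mult_left_le_one_le)
      also have "\<dots> = (\<Sum>d\<in>?W. u (\<lambda>k. i k + d k))" by (rule win)
      finally have "(cmod (kernel_operator K f (lattice_cell i)))\<^sup>2 \<le> (\<Sum>d\<in>?W. u (\<lambda>k. i k + d k))\<^sup>2"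
        by (rule power_mono) simp
      also have "\<dots> \<le> (\<Sum>d\<in>?W. (u (\<lambda>k. i k + d k))\<^sup>2) * C"
        unfolding C_def by (rule sum_squared_le_sum_of_squares)
      finally show ?thesis by (simp add: mult.commute)
    qed
    have summ: "(\<lambda>i. (cmod (kernel_operator K f (lattice_cell i)))\<^sup>2) summable_on UNIV"
      by (rule summable_on_comparison_test[OF has_sum_imp_summable[OF maj]]) (use le in auto)
    have "(\<Sum>\<^sub>\<infinity>i. (cmod (kernel_operator K f (lattice_cell i)))\<^sup>2) \<le> C * (\<Sum>d\<in>?W. S)"
      using infsum_mono[OF summ has_sum_imp_summable[OF maj]] le infsumI[OF maj] by simp
    also have "\<dots> = C\<^sup>2 * S" by (simp add: C_def power2_eq_square)
    finally have "l2_norm lattice_cells (kernel_operator K f) \<le> sqrt (C\<^sup>2 * S)"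
      unfolding l2_norm_lattice by (rule real_sqrt_le_mono)
    also have "\<dots> = C * l2_norm lattice_cells f"
      unfolding l2_norm_lattice S_def u_def by (simp add: real_sqrt_mult C_def)
    finally show ?thesis
      using summ unfolding l2_lattice_iff by (simp add: kernel_operator_def)
  qed
  show ?thesis
    unfolding bounded_l2_operator_def
  proof (intro conjI ballI allI)
    show "\<exists>C. \<forall>f\<in>l2 lattice_cells. l2_norm lattice_cells (kernel_operator K f) \<le> C * l2_norm lattice_cells f"
      using key by blast
  qed (use key in \<open>auto simp: kernel_operator_def fun_eq_iff sum.distrib sum_distrib_left algebra_simps\<close>)
qed

lemma lattice_laplacian_kernel: "lattice_laplacian = kernel_operator lattice_entry"
proof (intro ext)
  fix f :: "('v::finite \<Rightarrow> int) set \<Rightarrow> complex" and x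
  show "lattice_laplacian f x = kernel_operator lattice_entry f x"
  proof (cases "x \<in> lattice_cells")
    case True
    then obtain i where x: "x = lattice_cell i" by (rule lattice_cellsE)
    have "(\<Sum>\<^sub>\<infinity>y\<in>lattice_cells. connection x y * f y) = (\<Sum>\<^sub>\<infinity>j. lattice_entry i j * f (lattice_cell j))"
      unfolding x lattice_entry_def
      using infsum_reindex_bij_betw[OF lattice_cell_bij, of "\<lambda>y. connection (lattice_cell i) y * f y"] by simp
    also have "\<dots> = (\<Sum>\<^sub>\<infinity>j\<in>window 2 i. lattice_entry i j * f (lattice_cell j))"
      using finite_range_lattice_entry unfolding finite_range_def
      by (intro infsum_cong_neutral) auto
    also have "\<dots> = (\<Sum>j\<in>window 2 i. lattice_entry i j * f (lattice_cell j))"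
      by (rule infsum_finite[OF finite_window])
    finally show ?thesis
      unfolding x kernel_operator_cell by (simp add: lattice_laplacian_def x)
  qed (simp add: lattice_laplacian_def kernel_operator_def)
qed

lemma invertible_lattice_laplacian:
  "invertible_l2_operator (lattice_cells :: ('v::finite \<Rightarrow> int) set set) lattice_laplacian"
  unfolding invertible_l2_operator_def lattice_laplacian_kernel
proof (intro exI conjI ballI)
  show "bounded_l2_operator lattice_cells (kernel_operator (lattice_green :: ('v \<Rightarrow> int) \<Rightarrow> _))"
    by (rule bounded_kernel_operator[OF finite_range_lattice_green])
  fix f :: "('v \<Rightarrow> int) set \<Rightarrow> complex" assume "f \<in> l2 lattice_cells"
  then have f: "f x = 0" if "x \<notin> lattice_cells" for x using that by (simp add: l2_def)
  show "kernel_operator lattice_green (kernel_operator lattice_entry f) = f"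
    by (rule kernel_operator_inverse[OF finite_range_lattice_entry lattice_green_entry f])
  show "kernel_operator lattice_entry (kernel_operator lattice_green f) = f"
    by (rule kernel_operator_inverse[OF finite_range_lattice_green lattice_entry_green f])
qed

text \<open>
  A translation by a vector with even components permutes the vertices and the edges in each coordinate, so such
  vectors are exact periods of every diagonal, and every cube of radius \<open>1\<close> contains one.
\<close>

lemma almost_periodic_lattice_entry:
  "almost_periodic_operator (lattice_entry :: ('v::finite \<Rightarrow> int) \<Rightarrow> ('v \<Rightarrow> int) \<Rightarrow> complex)"
  unfolding almost_periodic_operator_def almost_periodic_def
proof (intro allI impI)
  fix m :: "'v \<Rightarrow> int" and \<epsilon> :: real assume "0 < \<epsilon>"
  have "\<forall>a :: 'v \<Rightarrow> int. \<exists>p. (\<forall>k. \<bar>p k - a k\<bar> \<le> 1) \<and> (\<forall>i.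
      cmod (lattice_entry (\<lambda>k. i k + p k) (\<lambda>k. i k + p k + m k) - lattice_entry i (\<lambda>k. i k + m k)) < \<epsilon>)"
  proof (intro allI exI conjI)
    fix a i :: "'v \<Rightarrow> int" and k
    show "\<bar>2 * (a k div 2) - a k\<bar> \<le> 1" by presburger
    have "lattice_entry (\<lambda>k. i k + 2 * (a k div 2)) (\<lambda>k. i k + 2 * (a k div 2) + m k) = lattice_entry i (\<lambda>k. i k + m k)"
      unfolding lattice_entry_prod line_connection by (intro prod.cong) auto
    then show "cmod (lattice_entry (\<lambda>k. i k + 2 * (a k div 2)) (\<lambda>k. i k + 2 * (a k div 2) + m k)
        - lattice_entry i (\<lambda>k. i k + m k)) < \<epsilon>"
      using \<open>0 < \<epsilon>\<close> by simp
  qed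
  then show "\<exists>R. \<forall>a. \<exists>p. (\<forall>k. \<bar>p k - a k\<bar> \<le> R) \<and> (\<forall>i.
      cmod (lattice_entry (\<lambda>k. i k + p k) (\<lambda>k. i k + p k + m k) - lattice_entry i (\<lambda>k. i k + m k)) < \<epsilon>)"
    by (rule exI)
qed

section \<open>Weak limit and limiting operator\<close>

theorem theorem19:
  shows "(\<exists>dk. real_distribution dk \<and>
            weak_conv_m (\<lambda>n. torus_dk TYPE('v::finite) n) dk \<and>
            absolutely_continuous lborel dk \<and>
            (\<exists>a b. a < 0 \<and> 0 < b \<and> {a<..<b} \<inter> measure_support dk = {})) \<and>
         almost_periodic_operator
           (lattice_entry :: ('v \<Rightarrow> int) \<Rightarrow> ('v \<Rightarrow> int) \<Rightarrow> complex) \<and>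
         bounded_l2_operator (product_cells line_complex)
           (lattice_laplacian :: (('v \<Rightarrow> int) set \<Rightarrow> complex) \<Rightarrow> ('v \<Rightarrow> int) set \<Rightarrow> complex) \<and>
         invertible_l2_operator (product_cells line_complex)
           (lattice_laplacian :: (('v \<Rightarrow> int) set \<Rightarrow> complex) \<Rightarrow> ('v \<Rightarrow> int) set \<Rightarrow> complex)"
proof (intro conjI)
  show "\<exists>dk. real_distribution dk \<and> weak_conv_m (\<lambda>n. torus_dk TYPE('v) n) dk \<and>
      absolutely_continuous lborel dk \<and>
      (\<exists>a b. a < 0 \<and> 0 < b \<and> {a<..<b} \<inter> measure_support dk = {})"
  proof (intro exI[of _ "limit_law TYPE('v)"] conjI)
    show "real_distribution (limit_law TYPE('v))"
      by (rule real_distribution_limit_law)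
    show "\<exists>a b. a < 0 \<and> 0 < b \<and> {a<..<b} \<inter> measure_support (limit_law TYPE('v)) = {}"
      using measure_support_limit_law[where ?'v = 'v]
      by (intro exI[of _ "-((1 / 5) ^ CARD('v))"] exI[of _ "(1 / 5) ^ CARD('v)"]) simp
  qed (rule weak_conv_torus_dk absolutely_continuous_limit_law)+
  show "almost_periodic_operator (lattice_entry :: ('v \<Rightarrow> int) \<Rightarrow> ('v \<Rightarrow> int) \<Rightarrow> complex)"
    by (rule almost_periodic_lattice_entry)
  show "bounded_l2_operator (product_cells line_complex)
      (lattice_laplacian :: (('v \<Rightarrow> int) set \<Rightarrow> complex) \<Rightarrow> ('v \<Rightarrow> int) set \<Rightarrow> complex)"
    unfolding lattice_laplacian_kernel by (rule bounded_kernel_operator[OF finite_range_lattice_entry])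
  show "invertible_l2_operator (product_cells line_complex)
      (lattice_laplacian :: (('v \<Rightarrow> int) set \<Rightarrow> complex) \<Rightarrow> ('v \<Rightarrow> int) set \<Rightarrow> complex)"
    by (rule invertible_lattice_laplacian)
qed

end
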